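(* Let $n\ge2$, let $(K,g_K)$ be a closed $n$-dimensional smooth Riemannian manifold, $M=[0,1]\times K$, and $g=h_1(x)[dx^2+g_K]$, where $h_1$ is measurable and a.e. positive on $[0,1]$, and $h=h_1^{n-1}$ satisfies $\sqrt h\in L^1(0,1)$ and $\frac1{\sqrt h}\in L^1(0,1)$. Then for any boundary data $\psi=(\psi^0,\psi^1)\in H^2(\partial M)$ there exists a unique solution $u=\sum_{m=0}^\infty u_m(x)Y_m$ in $\dot H^1(M)$ of the Dirichlet problem $$-\Delta_gu=0\ \text{on }M,\qquad u=\psi\ \text{on }\partial M .$$ Moreover, for every $s\in\mathbb{R}$, the Dirichlet-to-Neumann map $\Lambda_g$ is well defined as a bounded operator from $H^s(\partial M)$ to $H^{s-2}(\partial M)$.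
   Context: $\partial M=\Gamma_0\cup\Gamma_1$ with $\Gamma_0=\{0\}\times K$, $\Gamma_1=\{1\}\times K$. $(Y_m)_{m\ge0}$ is an orthonormal basis of $L^2(K)$ with $-\Delta_{g_K}Y_m=\mu_mY_m$, $0=\mu_0<\mu_1\le\mu_2\le\dots\to\infty$ (so $K$ is connected). Boundary data are $\psi=(\psi^0,\psi^1)$, $\psi^j=\sum_m\psi^j_mY_m$ on $\Gamma_j$, and for $s\in\mathbb{R}$ $$H^s(\partial M)=\Big\{\psi:\ \sum_{m}(1+\mu_m)^s(|\psi_m^0|^2+|\psi_m^1|^2)<\infty\Big\}.$$ The homogeneous Sobolev space is $\dot H^1(M)=\{u:\int_M|\nabla u|_g^2\,dVol_g<\infty\}$, i.e. $$\dot H^1(M)=\Big\{u=\sum_mu_m(x)Y_m:\ \sum_{m}\int_0^1(|u_m'|^2+\mu_m|u_m|^2)\sqrt h(x)\,dx<\infty\Big\}.$$ A solution $u=\sum_mu_m(x)Y_m$ of the Dirichlet problem is understood by separation of variables: for each $m$, $u_m$ and $\sqrt h\,u_m'$ are absolutely continuous on $[0,1]$, $-\frac1{\sqrt h}(\sqrt h\,u_m')'=-\mu_mu_m$ a.e., $u_m(0)=\psi^0_m$, $u_m(1)=\psi^1_m$. The Dirichlet-to-Neumann map acts on each harmonic by $$\begin{pmatrix}\psi^0_m\\ \psi^1_m\end{pmatrix}Y_m\longmapsto\begin{pmatrix}-(\sqrt h\,u_m')(0)\\ (\sqrt h\,u_m')(1)\end{pmatrix}Y_m .$$ *)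

theory Defs
  imports "HOL-Analysis.Analysis"
begin

section \<open>Closed Riemannian manifolds in charts\<close>

definition partial_deriv ::
  "'n::finite \<Rightarrow> (real ^ 'n \<Rightarrow> 'b::real_normed_vector) \<Rightarrow> real ^ 'n \<Rightarrow> 'b" where
  "partial_deriv i f x = frechet_derivative f (at x) (axis i 1)"

text \<open>To be used for open \<open>S\<close> only.\<close>

primrec Ck_on :: "nat \<Rightarrow> (real ^ 'n::finite) set \<Rightarrow> (real ^ 'n \<Rightarrow> 'b::real_normed_vector) \<Rightarrow> bool" where
  "Ck_on 0 S f \<longleftrightarrow> continuous_on S f"
| "Ck_on (Suc k) S f \<longleftrightarrow>
     (\<forall>x\<in>S. f differentiable (at x)) \<and> (\<forall>i. Ck_on k S (partial_deriv i f))"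

definition smooth_on :: "(real ^ 'n::finite) set \<Rightarrow> (real ^ 'n \<Rightarrow> 'b::real_normed_vector) \<Rightarrow> bool" where
  "smooth_on S f \<longleftrightarrow> (\<forall>k. Ck_on k S f)"

text \<open>A chart is a pair \<open>(U, \<phi>)\<close>; only the values of \<open>\<phi>\<close> on \<open>U\<close> matter.\<close>

type_synonym ('k, 'n) chart = "'k set \<times> ('k \<Rightarrow> real ^ 'n)"

definition chart_inv :: "('k, 'n::finite) chart \<Rightarrow> real ^ 'n \<Rightarrow> 'k" where
  "chart_inv c = inv_into (fst c) (snd c)"

definition transition :: "('k, 'n::finite) chart \<Rightarrow> ('k, 'n) chart \<Rightarrow> real ^ 'n \<Rightarrow> real ^ 'n" where
  "transition c c' = snd c' \<circ> chart_inv c"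

definition smooth_atlas :: "'k topology \<Rightarrow> ('k, 'n::finite) chart set \<Rightarrow> bool" where
  "smooth_atlas K A \<longleftrightarrow>
     (\<forall>(U, \<phi>)\<in>A. openin K U \<and> open (\<phi> ` U) \<and>
        homeomorphic_map (subtopology K U) (top_of_set (\<phi> ` U)) \<phi>) \<and>
     (\<Union>(U, \<phi>)\<in>A. U) = topspace K \<and>
     (\<forall>c\<in>A. \<forall>c'\<in>A. smooth_on (snd c ` (fst c \<inter> fst c')) (transition c c'))"

text \<open>A metric is given by its matrix of components in each chart of the atlas, subject to the
  tensor transformation law on overlaps.\<close>

type_synonym ('k, 'n) metric_components = "('k, 'n) chart \<Rightarrow> real ^ 'n \<Rightarrow> real ^ 'n ^ 'n"

definition riemannian_metric ::
  "('k, 'n::finite) chart set \<Rightarrow> ('k, 'n) metric_components \<Rightarrow> bool" where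
  "riemannian_metric A G \<longleftrightarrow>
     (\<forall>c\<in>A. smooth_on (snd c ` fst c) (G c) \<and>
        (\<forall>x\<in>snd c ` fst c. transpose (G c x) = G c x \<and> (\<forall>v. v \<noteq> 0 \<longrightarrow> v \<bullet> (G c x *v v) > 0))) \<and>
     (\<forall>c\<in>A. \<forall>c'\<in>A. \<forall>x\<in>snd c ` (fst c \<inter> fst c').
        (let J = matrix (frechet_derivative (transition c c') (at x))
         in G c x = transpose J ** G c' (transition c c' x) ** J))"

definition closed_riemannian_manifold ::
  "'k topology \<Rightarrow> ('k, 'n::finite) chart set \<Rightarrow> ('k, 'n) metric_components \<Rightarrow> bool" where
  "closed_riemannian_manifold K A G \<longleftrightarrow>
     compact_space K \<and> Hausdorff_space K \<and> smooth_atlas K A \<and> riemannian_metric A G"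

text \<open>These conditions determine the Borel measure \<open>V\<close> uniquely, because the charts cover \<open>K\<close>.\<close>

definition riemannian_volume ::
  "'k topology \<Rightarrow> ('k, 'n::finite) chart set \<Rightarrow> ('k, 'n) metric_components \<Rightarrow> 'k measure \<Rightarrow> bool" where
  "riemannian_volume K A G V \<longleftrightarrow>
     sets V = sets (sigma (topspace K) {U. openin K U}) \<and>
     (\<forall>c\<in>A. \<forall>E\<in>sets V. E \<subseteq> fst c \<longrightarrow>
        emeasure V E = (\<integral>\<^sup>+x\<in>snd c ` E. ennreal (sqrt (det (G c x))) \<partial>lborel))"

definition smooth_function ::
  "('k, 'n::finite) chart set \<Rightarrow> ('k \<Rightarrow> complex) \<Rightarrow> bool" where
  "smooth_function A f \<longleftrightarrow> (\<forall>c\<in>A. smooth_on (snd c ` fst c) (f \<circ> chart_inv c))"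

text \<open>The Laplace--Beltrami operator in the coordinates of \<open>c\<close>,
  \<open>|G|^(-1/2) \<partial>_i (|G|^(1/2) G^(ij) \<partial>_j f)\<close>.\<close>

definition laplace_beltrami ::
  "('k, 'n::finite) metric_components \<Rightarrow> ('k, 'n) chart \<Rightarrow> ('k \<Rightarrow> complex) \<Rightarrow> 'k \<Rightarrow> complex" where
  "laplace_beltrami G c f p =
     (1 / sqrt (det (G c (snd c p)))) *\<^sub>R
       (\<Sum>i\<in>UNIV. partial_deriv i
          (\<lambda>x. sqrt (det (G c x)) *\<^sub>R
             (\<Sum>j\<in>UNIV. (matrix_inv (G c x) $ i $ j) *\<^sub>R partial_deriv j (f \<circ> chart_inv c) x))
          (snd c p))"

definition laplace_eigenfunction ::
  "('k, 'n::finite) chart set \<Rightarrow> ('k, 'n) metric_components \<Rightarrow> real \<Rightarrow> ('k \<Rightarrow> complex) \<Rightarrow> bool" where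
  "laplace_eigenfunction A G mu f \<longleftrightarrow>
     smooth_function A f \<and> (\<forall>c\<in>A. \<forall>p\<in>fst c. - laplace_beltrami G c f p = mu *\<^sub>R f p)"

section \<open>Orthonormal bases and expansions\<close>

definition L2_space :: "'k measure \<Rightarrow> ('k \<Rightarrow> complex) set" where
  "L2_space V = {f \<in> borel_measurable V. integrable V (\<lambda>k. (norm (f k))\<^sup>2)}"

definition L2_inner :: "'k measure \<Rightarrow> ('k \<Rightarrow> complex) \<Rightarrow> ('k \<Rightarrow> complex) \<Rightarrow> complex" where
  "L2_inner V f g = (\<integral>k. f k * cnj (g k) \<partial>V)"

definition L2_expansion ::
  "'k measure \<Rightarrow> (nat \<Rightarrow> 'k \<Rightarrow> complex) \<Rightarrow> (nat \<Rightarrow> complex) \<Rightarrow> ('k \<Rightarrow> complex) \<Rightarrow> bool" where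
  "L2_expansion V Y a f \<longleftrightarrow> f \<in> L2_space V \<and>
     (\<lambda>N. \<integral>\<^sup>+k. ennreal ((norm (f k - (\<Sum>m<N. a m * Y m k)))\<^sup>2) \<partial>V) \<longlonglongrightarrow> 0"

definition orthonormal_basis_L2 :: "'k measure \<Rightarrow> (nat \<Rightarrow> 'k \<Rightarrow> complex) \<Rightarrow> bool" where
  "orthonormal_basis_L2 V Y \<longleftrightarrow>
     (\<forall>m. Y m \<in> L2_space V) \<and>
     (\<forall>i j. L2_inner V (Y i) (Y j) = (if i = j then 1 else 0)) \<and>
     (\<forall>f\<in>L2_space V. L2_expansion V Y (\<lambda>m. L2_inner V f (Y m)) f)"

text \<open>\<open>u = \<Sum>\<^sub>m c\<^sub>m(x) Y\<^sub>m\<close> for a function \<open>u\<close> on \<open>[0,1] \<times> K\<close>.\<close>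

definition harmonic_expansion ::
  "'k measure \<Rightarrow> (nat \<Rightarrow> 'k \<Rightarrow> complex) \<Rightarrow> (nat \<Rightarrow> real \<Rightarrow> complex) \<Rightarrow> (real \<Rightarrow> 'k \<Rightarrow> complex) \<Rightarrow> bool" where
  "harmonic_expansion V Y c u \<longleftrightarrow>
     (\<lambda>(x, k). u x k) \<in> borel_measurable (lebesgue_on {0..1} \<Otimes>\<^sub>M V) \<and>
     (AE x in lebesgue_on {0..1}. L2_expansion V Y (\<lambda>m. c m x) (u x))"

section \<open>The Dirichlet problem by separation of variables\<close>

definition absolutely_continuous_on :: "real \<Rightarrow> real \<Rightarrow> (real \<Rightarrow> 'b::real_normed_vector) \<Rightarrow> bool" where
  "absolutely_continuous_on a b f \<longleftrightarrow>
     (\<forall>\<epsilon>>0. \<exists>\<delta>>0. \<forall>I. finite I \<and> (\<forall>(s, t)\<in>I. a \<le> s \<and> s < t \<and> t \<le> b) \<and>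
        disjoint_family_on (\<lambda>(s, t). {s<..<t}) I \<and> (\<Sum>(s, t)\<in>I. t - s) < \<delta> \<longrightarrow>
        (\<Sum>(s, t)\<in>I. norm (f t - f s)) < \<epsilon>)"

text \<open>\<open>\<surd>h w'\<close> is defined only almost everywhere; \<open>p\<close> is its absolutely continuous representative.
  By continuity, \<open>p\<close> is determined on \<open>[0,1]\<close>, in particular at the end points.\<close>

definition is_flux :: "(real \<Rightarrow> real) \<Rightarrow> (real \<Rightarrow> complex) \<Rightarrow> (real \<Rightarrow> complex) \<Rightarrow> bool" where
  "is_flux h w p \<longleftrightarrow> absolutely_continuous_on 0 1 p \<and>
     (AE x in lebesgue_on {0..1}.
        \<exists>d. (w has_vector_derivative d) (at x) \<and> p x = sqrt (h x) *\<^sub>R d)"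

text \<open>For \<open>g = h1 (dx\<^sup>2 + g\<^sub>K)\<close> and \<open>h = h1^(n-1)\<close>, one has
  \<open>\<Delta>\<^sub>g = (1/h1) ((1/\<surd>h) \<partial>\<^sub>x \<surd>h \<partial>\<^sub>x + \<Delta>\<^sub>K)\<close>, so \<open>-\<Delta>\<^sub>g(w(x) Y) = 0\<close> with \<open>-\<Delta>\<^sub>K Y = mu Y\<close> is the
  equation below.\<close>

definition mode_solution ::
  "(real \<Rightarrow> real) \<Rightarrow> real \<Rightarrow> complex \<times> complex \<Rightarrow> (real \<Rightarrow> complex) \<Rightarrow> (real \<Rightarrow> complex) \<Rightarrow> bool" where
  "mode_solution h mu b w p \<longleftrightarrow>
     absolutely_continuous_on 0 1 w \<and> is_flux h w p \<and>
     (AE x in lebesgue_on {0..1}.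
        \<exists>d. (p has_vector_derivative d) (at x) \<and> - ((1 / sqrt (h x)) *\<^sub>R d) = - (mu *\<^sub>R w x)) \<and>
     w 0 = fst b \<and> w 1 = snd b"

text \<open>Boundary data are given by their coefficients, \<open>\<psi> m = (\<psi>\<^sup>0\<^sub>m, \<psi>\<^sup>1\<^sub>m)\<close>; for negative \<open>s\<close> the
  series \<open>\<Sum>\<^sub>m \<psi>\<^sup>j\<^sub>m Y\<^sub>m\<close> is a distribution and need not be a function.\<close>

type_synonym boundary_data = "nat \<Rightarrow> complex \<times> complex"

definition Hs_term :: "(nat \<Rightarrow> real) \<Rightarrow> real \<Rightarrow> boundary_data \<Rightarrow> nat \<Rightarrow> real" where
  "Hs_term \<mu> s \<psi> m = (1 + \<mu> m) powr s * ((norm (fst (\<psi> m)))\<^sup>2 + (norm (snd (\<psi> m)))\<^sup>2)"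

definition Hs :: "(nat \<Rightarrow> real) \<Rightarrow> real \<Rightarrow> boundary_data set" where
  "Hs \<mu> s = {\<psi>. summable (Hs_term \<mu> s \<psi>)}"

definition Hs_norm :: "(nat \<Rightarrow> real) \<Rightarrow> real \<Rightarrow> boundary_data \<Rightarrow> real" where
  "Hs_norm \<mu> s \<psi> = sqrt (\<Sum>m. Hs_term \<mu> s \<psi> m)"

definition dirichlet_solution ::
  "(real \<Rightarrow> real) \<Rightarrow> (nat \<Rightarrow> real) \<Rightarrow> 'k measure \<Rightarrow> (nat \<Rightarrow> 'k \<Rightarrow> complex) \<Rightarrow> boundary_data \<Rightarrow>
     (real \<Rightarrow> 'k \<Rightarrow> complex) \<Rightarrow> bool" where
  "dirichlet_solution h \<mu> V Y \<psi> u \<longleftrightarrow>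
     (\<exists>c. harmonic_expansion V Y c u \<and> (\<forall>m. \<exists>p. mode_solution h (\<mu> m) (\<psi> m) (c m) p))"

text \<open>The weak derivatives \<open>c\<^sub>m'\<close> are integrable when the energy is finite and \<open>1/\<surd>h\<close> is integrable
  (Cauchy--Schwarz), so the coefficients have absolutely continuous representatives.\<close>

definition H1_dot ::
  "(real \<Rightarrow> real) \<Rightarrow> (nat \<Rightarrow> real) \<Rightarrow> 'k measure \<Rightarrow> (nat \<Rightarrow> 'k \<Rightarrow> complex) \<Rightarrow>
     (real \<Rightarrow> 'k \<Rightarrow> complex) set" where
  "H1_dot h \<mu> V Y =
     {u. \<exists>c. harmonic_expansion V Y c u \<and> (\<forall>m. absolutely_continuous_on 0 1 (c m)) \<and>
        (\<Sum>m. \<integral>\<^sup>+x. ennreal (((norm (vector_derivative (c m) (at x)))\<^sup>2 + \<mu> m * (norm (c m x))\<^sup>2)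
                 * sqrt (h x)) \<partial>lebesgue_on {0..1}) < \<infinity>}"

section \<open>The Dirichlet-to-Neumann map\<close>

definition DN_graph :: "(real \<Rightarrow> real) \<Rightarrow> (nat \<Rightarrow> real) \<Rightarrow> boundary_data \<Rightarrow> boundary_data \<Rightarrow> bool" where
  "DN_graph h \<mu> \<psi> \<phi> \<longleftrightarrow>
     (\<forall>m. \<exists>w p. mode_solution h (\<mu> m) (\<psi> m) w p \<and> \<phi> m = (- p 0, p 1))"

definition DN_map :: "(real \<Rightarrow> real) \<Rightarrow> (nat \<Rightarrow> real) \<Rightarrow> boundary_data \<Rightarrow> boundary_data" where
  "DN_map h \<mu> \<psi> = (THE \<phi>. DN_graph h \<mu> \<psi> \<phi>)"

definition bounded_operator_Hs ::
  "(nat \<Rightarrow> real) \<Rightarrow> real \<Rightarrow> real \<Rightarrow> (boundary_data \<Rightarrow> boundary_data) \<Rightarrow> bool" where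
  "bounded_operator_Hs \<mu> s t T \<longleftrightarrow>
     (\<forall>\<psi>\<in>Hs \<mu> s. \<forall>\<phi>\<in>Hs \<mu> s. T (\<lambda>m. \<psi> m + \<phi> m) = (\<lambda>m. T \<psi> m + T \<phi> m)) \<and>
     (\<forall>\<psi>\<in>Hs \<mu> s. \<forall>a. T (\<lambda>m. (a * fst (\<psi> m), a * snd (\<psi> m))) =
        (\<lambda>m. (a * fst (T \<psi> m), a * snd (T \<psi> m)))) \<and>
     (\<exists>C. \<forall>\<psi>\<in>Hs \<mu> s. T \<psi> \<in> Hs \<mu> t \<and> Hs_norm \<mu> t (T \<psi>) \<le> C * Hs_norm \<mu> s \<psi>)"

end

theory Submission
  imports Defs
begin

text \<open>Separation of variables leaves one Sturm--Liouville equation for each harmonic. For the mode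
  \<open>w = u\<^sub>m\<close> and its flux \<open>p = \<surd>h u\<^sub>m'\<close> it is the first-order system \<open>w' = r p\<close>, \<open>p' = q w\<close> with
  \<open>r = 1/\<surd>h\<close> and \<open>q = \<mu>\<^sub>m \<surd>h\<close>. The hypotheses on \<open>h\<close> say that these nonnegative coefficients are
  integrable, which is what a linear system with absolutely continuous solutions needs.

  All estimates come from one sign. Since \<open>(w \<bullet> p)' = r |p|\<^sup>2 + q |w|\<^sup>2 \<ge> 0\<close> and
  \<open>(|w|\<^sup>2)' = 2 r (w \<bullet> p)\<close>, the function \<open>|w|\<^sup>2\<close> first decreases and then increases, so \<open>|w|\<close> is at
  most its larger boundary value (\<open>flux_system_norm_le\<close>). This maximum principle gives uniqueness
  for the boundary value problem. Uniqueness shows that the solution with \<open>w(0) = 0\<close>, \<open>p(0) = 1\<close>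
  does not vanish at \<open>1\<close>; superposing it with the solution with \<open>w(0) = 1\<close>, \<open>p(0) = 0\<close> then
  reaches all boundary values (\<open>flux_system_boundary_value\<close>). Both solutions come from a monotone
  Picard iteration.

  The maximum principle also controls the flux: \<open>p\<close> oscillates by at most \<open>\<integral> q |w|\<close>, and
  \<open>\<integral> r p = w(1) - w(0)\<close> fixes its mean. Hence \<open>|p| \<le> C (1 + \<mu>\<^sub>m) (|\<psi>\<^sup>0\<^sub>m| + |\<psi>\<^sup>1\<^sub>m|)\<close> with \<open>C\<close>
  independent of \<open>m\<close> (\<open>mode_solution_flux_le\<close>). One factor \<open>1 + \<mu>\<^sub>m\<close> costs two Sobolev orders,
  which is the bound for the Dirichlet-to-Neumann map. It also bounds the energy of the mode by a
  constant times \<open>(1 + \<mu>\<^sub>m)\<^sup>2 (|\<psi>\<^sup>0\<^sub>m|\<^sup>2 + |\<psi>\<^sup>1\<^sub>m|\<^sup>2)\<close>, the general term of the squared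
  \<open>H\<^sup>2\<close> norm, so the total energy is finite.

  To assemble \<open>u\<close>, note that \<open>|u\<^sub>m(x)| \<le> |\<psi>\<^sup>0\<^sub>m| + |\<psi>\<^sup>1\<^sub>m|\<close> makes \<open>\<Sum>\<^sub>m u\<^sub>m(x) Y\<^sub>m\<close> converge in
  \<open>L\<^sup>2(K)\<close> at a rate independent of \<open>x\<close>. One subsequence of the partial sums therefore converges
  almost everywhere for every \<open>x\<close>, and its pointwise limit is jointly measurable
  (\<open>L2_expansion_exists_measurable\<close>).\<close>

section \<open>Absolutely continuous functions\<close>

lemma absolutely_continuous_onE:
  assumes "absolutely_continuous_on a b f" "\<epsilon> > 0"
  obtains \<delta> where "\<delta> > 0"
    "\<And>I. finite I \<Longrightarrow> (\<And>s t. (s, t) \<in> I \<Longrightarrow> a \<le> s \<and> s < t \<and> t \<le> b) \<Longrightarrow>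
       disjoint_family_on (\<lambda>(s, t). {s<..<t}) I \<Longrightarrow> (\<Sum>(s, t)\<in>I. t - s) < \<delta> \<Longrightarrow>
       (\<Sum>(s, t)\<in>I. norm (f t - f s)) < \<epsilon>"
proof -
  obtain \<delta> where "\<delta> > 0" and d: "\<forall>I. finite I \<and> (\<forall>(s, t)\<in>I. a \<le> s \<and> s < t \<and> t \<le> b) \<and>
        disjoint_family_on (\<lambda>(s, t). {s<..<t}) I \<and> (\<Sum>(s, t)\<in>I. t - s) < \<delta> \<longrightarrow>
        (\<Sum>(s, t)\<in>I. norm (f t - f s)) < \<epsilon>"
    using assms unfolding absolutely_continuous_on_def by blast
  show ?thesis
    by (rule that[OF \<open>\<delta> > 0\<close>]) (use d in blast)
qed

lemma absolutely_continuous_on_subinterval: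
  assumes "absolutely_continuous_on a b f" "a \<le> c" "d \<le> b"
  shows "absolutely_continuous_on c d f"
  unfolding absolutely_continuous_on_def
proof (intro allI impI)
  fix \<epsilon> :: real assume "\<epsilon> > 0"
  from absolutely_continuous_onE[OF assms(1) this] obtain \<delta> where \<delta>: "\<delta> > 0"
    "\<And>I. finite I \<Longrightarrow> (\<And>s t. (s, t) \<in> I \<Longrightarrow> a \<le> s \<and> s < t \<and> t \<le> b) \<Longrightarrow>
       disjoint_family_on (\<lambda>(s, t). {s<..<t}) I \<Longrightarrow> (\<Sum>(s, t)\<in>I. t - s) < \<delta> \<Longrightarrow>
       (\<Sum>(s, t)\<in>I. norm (f t - f s)) < \<epsilon>" by metis
  show "\<exists>\<delta>>0. \<forall>I. finite I \<and> (\<forall>(s, t)\<in>I. c \<le> s \<and> s < t \<and> t \<le> d) \<and>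
        disjoint_family_on (\<lambda>(s, t). {s<..<t}) I \<and> (\<Sum>(s, t)\<in>I. t - s) < \<delta> \<longrightarrow>
        (\<Sum>(s, t)\<in>I. norm (f t - f s)) < \<epsilon>"
  proof (intro exI[of _ \<delta>] conjI allI impI \<delta>(1))
    fix I assume I: "finite I \<and> (\<forall>(s, t)\<in>I. c \<le> s \<and> s < t \<and> t \<le> d) \<and>
        disjoint_family_on (\<lambda>(s, t). {s<..<t}) I \<and> (\<Sum>(s, t)\<in>I. t - s) < \<delta>"
    show "(\<Sum>(s, t)\<in>I. norm (f t - f s)) < \<epsilon>"
      by (rule \<delta>(2)) (use I assms(2,3) in force)+
  qed
qed

lemma absolutely_continuous_on_imp_continuous_on:
  assumes "absolutely_continuous_on a b f"
  shows "continuous_on {a..b} f"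
  unfolding continuous_on_iff
proof (intro ballI allI impI)
  fix x and \<epsilon> :: real assume x: "x \<in> {a..b}" and "\<epsilon> > 0"
  from absolutely_continuous_onE[OF assms this(2)] obtain \<delta> where \<delta>: "\<delta> > 0"
    "\<And>I. finite I \<Longrightarrow> (\<And>s t. (s, t) \<in> I \<Longrightarrow> a \<le> s \<and> s < t \<and> t \<le> b) \<Longrightarrow>
       disjoint_family_on (\<lambda>(s, t). {s<..<t}) I \<Longrightarrow> (\<Sum>(s, t)\<in>I. t - s) < \<delta> \<Longrightarrow>
       (\<Sum>(s, t)\<in>I. norm (f t - f s)) < \<epsilon>" by metis
  have *: "norm (f t - f s) < \<epsilon>" if "a \<le> s" "s < t" "t \<le> b" "t - s < \<delta>" for s t
    using \<delta>(2)[of "{(s, t)}"] that by (simp add: disjoint_family_on_def)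
  show "\<exists>d>0. \<forall>x'\<in>{a..b}. dist x' x < d \<longrightarrow> dist (f x') (f x) < \<epsilon>"
  proof (intro exI[of _ \<delta>] conjI ballI impI \<delta>(1))
    fix y assume "y \<in> {a..b}" "dist y x < \<delta>"
    then show "dist (f y) (f x) < \<epsilon>"
      using *[of x y] *[of y x] x \<open>\<epsilon> > 0\<close>
      by (cases x y rule: linorder_cases) (auto simp: dist_norm norm_minus_commute)
  qed
qed

text \<open>Sums, products, bounded linear images and compositions with Lipschitz functions all have their
  increments dominated by those of at most two absolutely continuous functions, so one estimate
  covers them.\<close>

lemma absolutely_continuous_on_dominated:
  assumes g: "absolutely_continuous_on a b g" and k: "absolutely_continuous_on a b k"
    and dom: "\<And>s t. a \<le> s \<Longrightarrow> s < t \<Longrightarrow> t \<le> b \<Longrightarrow>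
      norm (f t - f s) \<le> B * (norm (g t - g s) + norm (k t - k s))"
  shows "absolutely_continuous_on a b f"
  unfolding absolutely_continuous_on_def
proof (intro allI impI)
  fix \<epsilon> :: real assume "\<epsilon> > 0"
  define C where "C = max B 1"
  have "C > 0" by (simp add: C_def)
  then have e: "\<epsilon> / (2 * C) > 0" using \<open>\<epsilon> > 0\<close> by simp
  from absolutely_continuous_onE[OF g e] obtain \<delta>1 where \<delta>1: "\<delta>1 > 0"
    "\<And>I. finite I \<Longrightarrow> (\<And>s t. (s, t) \<in> I \<Longrightarrow> a \<le> s \<and> s < t \<and> t \<le> b) \<Longrightarrow>
       disjoint_family_on (\<lambda>(s, t). {s<..<t}) I \<Longrightarrow> (\<Sum>(s, t)\<in>I. t - s) < \<delta>1 \<Longrightarrow>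
       (\<Sum>(s, t)\<in>I. norm (g t - g s)) < \<epsilon> / (2 * C)" by metis
  from absolutely_continuous_onE[OF k e] obtain \<delta>2 where \<delta>2: "\<delta>2 > 0"
    "\<And>I. finite I \<Longrightarrow> (\<And>s t. (s, t) \<in> I \<Longrightarrow> a \<le> s \<and> s < t \<and> t \<le> b) \<Longrightarrow>
       disjoint_family_on (\<lambda>(s, t). {s<..<t}) I \<Longrightarrow> (\<Sum>(s, t)\<in>I. t - s) < \<delta>2 \<Longrightarrow>
       (\<Sum>(s, t)\<in>I. norm (k t - k s)) < \<epsilon> / (2 * C)" by metis
  show "\<exists>\<delta>>0. \<forall>I. finite I \<and> (\<forall>(s, t)\<in>I. a \<le> s \<and> s < t \<and> t \<le> b) \<and>
        disjoint_family_on (\<lambda>(s, t). {s<..<t}) I \<and> (\<Sum>(s, t)\<in>I. t - s) < \<delta> \<longrightarrow>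
        (\<Sum>(s, t)\<in>I. norm (f t - f s)) < \<epsilon>"
  proof (intro exI[of _ "min \<delta>1 \<delta>2"] conjI allI impI)
    show "min \<delta>1 \<delta>2 > 0" using \<delta>1(1) \<delta>2(1) by simp
    fix I assume I: "finite I \<and> (\<forall>(s, t)\<in>I. a \<le> s \<and> s < t \<and> t \<le> b) \<and>
        disjoint_family_on (\<lambda>(s, t). {s<..<t}) I \<and> (\<Sum>(s, t)\<in>I. t - s) < min \<delta>1 \<delta>2"
    have 1: "(\<Sum>(s, t)\<in>I. norm (g t - g s)) < \<epsilon> / (2 * C)" by (rule \<delta>1(2)) (use I in force)+
    have 2: "(\<Sum>(s, t)\<in>I. norm (k t - k s)) < \<epsilon> / (2 * C)" by (rule \<delta>2(2)) (use I in force)+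
    have "(\<Sum>(s, t)\<in>I. norm (f t - f s)) \<le> (\<Sum>(s, t)\<in>I. C * (norm (g t - g s) + norm (k t - k s)))"
    proof (rule sum_mono, clarify)
      fix s t assume "(s, t) \<in> I"
      then have "norm (f t - f s) \<le> B * (norm (g t - g s) + norm (k t - k s))"
        using I dom by blast
      also have "\<dots> \<le> C * (norm (g t - g s) + norm (k t - k s))"
        by (rule mult_right_mono) (auto simp: C_def)
      finally show "norm (f t - f s) \<le> C * (norm (g t - g s) + norm (k t - k s))" .
    qed
    also have "\<dots> = C * ((\<Sum>(s, t)\<in>I. norm (g t - g s)) + (\<Sum>(s, t)\<in>I. norm (k t - k s)))"
      by (simp add: sum_distrib_left sum.distrib case_prod_unfold distrib_left)
    also have "\<dots> < C * (\<epsilon> / (2 * C) + \<epsilon> / (2 * C))"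
      using 1 2 \<open>C > 0\<close> by (intro mult_strict_left_mono add_strict_mono) auto
    also have "\<dots> = \<epsilon>" using \<open>C > 0\<close> by (simp add: field_simps)
    finally show "(\<Sum>(s, t)\<in>I. norm (f t - f s)) < \<epsilon>" .
  qed
qed

lemma absolutely_continuous_on_add:
  assumes "absolutely_continuous_on a b f" "absolutely_continuous_on a b g"
  shows "absolutely_continuous_on a b (\<lambda>x. f x + g x)"
  using assms
proof (rule absolutely_continuous_on_dominated[where B=1])
  show "norm (f t + g t - (f s + g s)) \<le> 1 * (norm (f t - f s) + norm (g t - g s))" for s t
    using norm_triangle_ineq[of "f t - f s" "g t - g s"] by (simp add: algebra_simps)
qed

lemma absolutely_continuous_on_bounded_linear:
  assumes T: "bounded_linear T" and f: "absolutely_continuous_on a b f"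
  shows "absolutely_continuous_on a b (\<lambda>x. T (f x))"
proof -
  obtain C where C: "\<And>x. norm (T x) \<le> norm x * C" "C > 0"
    using bounded_linear.pos_bounded[OF T] by blast
  have "norm (T (f t) - T (f s)) \<le> C * (norm (f t - f s) + norm (f t - f s))" for s t
  proof -
    have "norm (T (f t) - T (f s)) \<le> norm (f t - f s) * C"
      using C(1)[of "f t - f s"] by (simp add: linear_diff[OF bounded_linear.linear[OF T]])
    also have "\<dots> \<le> (norm (f t - f s) + norm (f t - f s)) * C"
      using C(2) by (intro mult_right_mono) auto
    finally show ?thesis by (simp add: mult.commute)
  qed
  then show ?thesis by (rule absolutely_continuous_on_dominated[OF f f])
qed

lemma absolutely_continuous_on_bounded_bilinear:
  assumes T: "bounded_bilinear T" and f: "absolutely_continuous_on a b f"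
    and g: "absolutely_continuous_on a b g"
  shows "absolutely_continuous_on a b (\<lambda>x. T (f x) (g x))"
proof -
  obtain C where C: "\<And>x y. norm (T x y) \<le> norm x * norm y * C" "C > 0"
    using bounded_bilinear.pos_bounded[OF T] by blast
  have "bounded (f ` {a..b})" "bounded (g ` {a..b})"
    using f g by (auto intro!: compact_imp_bounded compact_continuous_image
        absolutely_continuous_on_imp_continuous_on)
  then obtain M N where M: "\<And>x. x \<in> {a..b} \<Longrightarrow> norm (f x) \<le> M"
    and N: "\<And>x. x \<in> {a..b} \<Longrightarrow> norm (g x) \<le> N"
    unfolding bounded_iff by blast
  have "norm (T (f t) (g t) - T (f s) (g s))
      \<le> (max M N * C) * (norm (f t - f s) + norm (g t - g s))"
    if "a \<le> s" "s < t" "t \<le> b" for s t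
  proof -
    have MN0: "0 \<le> max M N" using M[of s] that norm_ge_zero[of "f s"]
      by (smt (verit) atLeastAtMost_iff)
    have MN: "norm (g t) \<le> max M N" "norm (f s) \<le> max M N"
      using M[of s] N[of t] that by auto
    have "T (f t) (g t) - T (f s) (g s) = T (f t - f s) (g t) + T (f s) (g t - g s)"
      by (simp add: bounded_bilinear.diff_left[OF T] bounded_bilinear.diff_right[OF T])
    then have "norm (T (f t) (g t) - T (f s) (g s))
        \<le> norm (f t - f s) * norm (g t) * C + norm (f s) * norm (g t - g s) * C"
      by (metis norm_triangle_le C(1) add_mono)
    also have "\<dots> \<le> norm (f t - f s) * max M N * C + max M N * norm (g t - g s) * C"
      using MN MN0 \<open>C > 0\<close> by (intro add_mono mult_mono mult_nonneg_nonneg) auto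
    finally show ?thesis by (simp add: algebra_simps)
  qed
  then show ?thesis by (rule absolutely_continuous_on_dominated[OF f g])
qed

text \<open>The Henstock integral makes this direct. The gauge at a point of differentiability is given by
  the straddle estimate. On \<open>N\<close> it is chosen such that tagged intervals with tags in \<open>N\<close> have small
  total length, because the indicator function of \<open>N\<close> has integral \<open>0\<close>; absolute continuity then
  bounds the increments of \<open>f\<close> over these intervals.\<close>

lemma fundamental_theorem_of_calculus_absolutely_continuous:
  fixes f :: "real \<Rightarrow> 'a::euclidean_space"
  assumes ac: "absolutely_continuous_on a b f" and "a \<le> b" and N: "negligible N"
    and der: "\<And>x. x \<in> {a..b} - N \<Longrightarrow> (f has_vector_derivative f' x) (at x)"
  shows "(f' has_integral (f b - f a)) {a..b}"
proof -
  define g where "g x = (if x \<in> N then 0 else f' x)" for x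
  have "(g has_integral (f b - f a)) {a..b}"
    unfolding has_integral_real
  proof (intro allI impI)
    fix \<epsilon> :: real assume "\<epsilon> > 0"
    then have e2: "\<epsilon> / 2 > 0" by simp
    define \<eta> where "\<eta> = \<epsilon> / (2 * (b - a + 1))"
    have "\<eta> > 0" using \<open>\<epsilon> > 0\<close> \<open>a \<le> b\<close> by (simp add: \<eta>_def)
    from absolutely_continuous_onE[OF ac e2] obtain \<delta> where \<delta>: "\<delta> > 0"
      "\<And>I. finite I \<Longrightarrow> (\<And>s t. (s, t) \<in> I \<Longrightarrow> a \<le> s \<and> s < t \<and> t \<le> b) \<Longrightarrow>
       disjoint_family_on (\<lambda>(s, t). {s<..<t}) I \<Longrightarrow> (\<Sum>(s, t)\<in>I. t - s) < \<delta> \<Longrightarrow>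
       (\<Sum>(s, t)\<in>I. norm (f t - f s)) < \<epsilon> / 2" by metis
    have "((indicator N :: real \<Rightarrow> real) has_integral 0) {a..b}"
      using N unfolding negligible_def cbox_interval by blast
    then obtain \<gamma>1 where \<gamma>1: "gauge \<gamma>1" "\<And>\<D>. \<D> tagged_division_of {a..b} \<Longrightarrow> \<gamma>1 fine \<D> \<Longrightarrow>
        norm ((\<Sum>(x,k)\<in>\<D>. measure lborel k *\<^sub>R (indicator N x :: real)) - 0) < \<delta>"
      using \<delta>(1) unfolding has_integral_real by meson
    have "\<exists>d>0. x \<in> {a..b} - N \<longrightarrow> (\<forall>y. \<bar>y - x\<bar> < d \<longrightarrow>
        norm (f y - f x - (y - x) *\<^sub>R f' x) \<le> \<eta> * \<bar>y - x\<bar>)" for x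
    proof (cases "x \<in> {a..b} - N")
      case True
      then have "(f has_derivative (\<lambda>h. h *\<^sub>R f' x)) (at x)"
        using der has_vector_derivative_def by blast
      then show ?thesis
        using \<open>\<eta> > 0\<close> unfolding has_derivative_at_alt by fastforce
    qed (auto intro: exI[of _ 1])
    then obtain d where d: "\<And>x. d x > 0" "\<And>x y. x \<in> {a..b} - N \<Longrightarrow> \<bar>y - x\<bar> < d x \<Longrightarrow>
        norm (f y - f x - (y - x) *\<^sub>R f' x) \<le> \<eta> * \<bar>y - x\<bar>" by metis
    define \<gamma> where "\<gamma> x = \<gamma>1 x \<inter> ball x (d x)" for x
    have "gauge \<gamma>" using \<gamma>1(1) d(1) by (auto simp: gauge_def \<gamma>_def)
    show "\<exists>\<gamma>. gauge \<gamma> \<and> (\<forall>\<D>. \<D> tagged_division_of {a..b} \<and> \<gamma> fine \<D> \<longrightarrow>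
        norm ((\<Sum>(x, k)\<in>\<D>. measure lborel k *\<^sub>R g x) - (f b - f a)) < \<epsilon>)"
    proof (intro exI[of _ \<gamma>] conjI allI impI \<open>gauge \<gamma>\<close>)
      fix \<D> assume "\<D> tagged_division_of {a..b} \<and> \<gamma> fine \<D>"
      then have D: "\<D> tagged_division_of {a..b}" "\<gamma> fine \<D>" by auto
      note Dp = tagged_division_ofD[OF D(1)]
      have fine: "\<gamma>1 fine \<D>" using D(2) by (auto simp: fine_def \<gamma>_def)
      have K: "\<exists>s t. k = {s..t} \<and> s \<le> t \<and> a \<le> s \<and> t \<le> b \<and> x \<in> {s..t}
          \<and> Sup k = t \<and> Inf k = s \<and> measure lborel k = t - s" if xk: "(x, k) \<in> \<D>" for x k
      proof -
        obtain s t where k: "k = {s..t}" using Dp(4)[OF xk] by auto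
        have x: "x \<in> k" and "k \<subseteq> {a..b}" using Dp(2,3)[OF xk] by auto
        then show ?thesis using k by (intro exI[of _ s] exI[of _ t]) auto
      qed
      \<comment> \<open>Tagged intervals may be degenerate; they carry no increment, and without them distinct tagged intervals have distinct end points.\<close>
      define DN where "DN = {xk \<in> \<D>. fst xk \<in> N \<and> measure lborel (snd xk) \<noteq> 0}"
      define I where "I = (\<lambda>(x, k). (Inf k :: real, Sup k :: real)) ` DN"
      have finDN: "finite DN" using Dp(1) by (simp add: DN_def)
      have disj: "x = y \<and> k = l \<or> {Inf k<..<Sup k} \<inter> {Inf l<..<Sup l} = {}"
        if xk: "(x, k) \<in> \<D>" and yl: "(y, l) \<in> \<D>" for x y :: real and k l
      proof -
        obtain s t where k: "k = {s..t}" "Sup k = t" "Inf k = s" using K[OF xk] by blast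
        obtain s' t' where l: "l = {s'..t'}" "Sup l = t'" "Inf l = s'" using K[OF yl] by blast
        have "(x, k) \<noteq> (y, l) \<Longrightarrow> interior k \<inter> interior l = {}" using Dp(5)[OF xk yl] by auto
        then show ?thesis using k l by (auto simp: interior_atLeastAtMost_real)
      qed
      have inj: "inj_on (\<lambda>(x, k). (Inf k :: real, Sup k :: real)) DN"
      proof (rule inj_onI, clarify)
        fix x k y l assume *: "(x, k) \<in> DN" "(y, l) \<in> DN" "Inf k = Inf l" "Sup k = Sup l"
        then have "{Inf k<..<Sup k} \<noteq> {}" using K[of x k] by (auto simp: DN_def)
        with disj[of x k y l] * show "x = y \<and> k = l" by (auto simp: DN_def)
      qed
      have lenI: "(\<Sum>(s, t)\<in>I. t - s) < \<delta>"
      proof -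
        have "(\<Sum>(s, t)\<in>I. t - s) = (\<Sum>(x, k)\<in>DN. measure lborel k)"
          unfolding I_def by (subst sum.reindex[OF inj], rule sum.cong[OF refl])
            (use K in \<open>fastforce simp: DN_def\<close>)
        also have "\<dots> = (\<Sum>(x, k)\<in>DN. measure lborel k *\<^sub>R (indicator N x :: real))"
          by (rule sum.cong[OF refl]) (auto simp: DN_def)
        also have "\<dots> = (\<Sum>(x, k)\<in>\<D>. measure lborel k *\<^sub>R (indicator N x :: real))"
          by (rule sum.mono_neutral_left) (use Dp(1) in \<open>auto simp: DN_def indicator_def\<close>)
        also have "\<dots> < \<delta>" using \<gamma>1(2)[OF D(1) fine] by simp
        finally show ?thesis .
      qed
      have "(\<Sum>(s, t)\<in>I. norm (f t - f s)) < \<epsilon> / 2"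
      proof (rule \<delta>(2))
        show "finite I" using finDN by (simp add: I_def)
        show "a \<le> s \<and> s < t \<and> t \<le> b" if "(s, t) \<in> I" for s t
        proof -
          obtain x k where "(x, k) \<in> DN" "s = Inf k" "t = Sup k" using \<open>(s, t) \<in> I\<close> by (auto simp: I_def)
          then show ?thesis using K[of x k] by (auto simp: DN_def)
        qed
        show "disjoint_family_on (\<lambda>(s, t). {s<..<t}) I"
          unfolding disjoint_family_on_def
        proof (intro ballI impI)
          fix m n assume mn: "m \<in> I" "n \<in> I" "m \<noteq> n"
          obtain x k where xk: "(x, k) \<in> DN" "m = (Inf k, Sup k)" using mn by (auto simp: I_def)
          obtain y l where yl: "(y, l) \<in> DN" "n = (Inf l, Sup l)" using mn by (auto simp: I_def)
          show "(case m of (s, t) \<Rightarrow> {s<..<t}) \<inter> (case n of (s, t) \<Rightarrow> {s<..<t}) = {}"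
            using disj[of x k y l] xk yl mn(3) by (auto simp: DN_def)
        qed
      qed (rule lenI)
      then have bad: "(\<Sum>(x, k)\<in>DN. norm (f (Sup k) - f (Inf k))) < \<epsilon> / 2"
        unfolding I_def by (subst (asm) sum.reindex[OF inj]) (simp add: case_prod_unfold comp_def)
      have tag_bound: "norm (measure lborel k *\<^sub>R g x - (f (Sup k) - f (Inf k)))
          \<le> \<eta> * measure lborel k + (if (x, k) \<in> DN then norm (f (Sup k) - f (Inf k)) else 0)"
        if xk: "(x, k) \<in> \<D>" for x k
      proof -
        obtain s t where k: "k = {s..t}" "s \<le> t" "a \<le> s" "t \<le> b" "x \<in> {s..t}"
          "Sup k = t" "Inf k = s" "measure lborel k = t - s" using K[OF xk] by blast
        show ?thesis
        proof (cases "x \<in> N")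
          case True
          then show ?thesis
            using k xk \<open>\<eta> > 0\<close> by (auto simp: DN_def g_def norm_minus_commute)
        next
          case False
          have "k \<subseteq> ball x (d x)" using D(2) xk by (auto simp: fine_def \<gamma>_def)
          moreover have "s \<in> k" "t \<in> k" using k by auto
          ultimately have "s \<in> ball x (d x)" "t \<in> ball x (d x)" by auto
          then have st: "\<bar>s - x\<bar> < d x" "\<bar>t - x\<bar> < d x" by (auto simp: dist_real_def)
          have x: "x \<in> {a..b} - N" using False k by auto
          have "measure lborel k *\<^sub>R g x - (f (Sup k) - f (Inf k))
              = (f s - f x - (s - x) *\<^sub>R f' x) - (f t - f x - (t - x) *\<^sub>R f' x)"
            using k False by (simp add: g_def algebra_simps)
          also have "norm \<dots> \<le> \<eta> * \<bar>s - x\<bar> + \<eta> * \<bar>t - x\<bar>"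
            using d(2)[OF x st(1)] d(2)[OF x st(2)] norm_triangle_ineq4 by (smt (verit))
          also have "\<dots> = \<eta> * measure lborel k" using k by (simp add: algebra_simps)
          finally show ?thesis using False by (simp add: DN_def)
        qed
      qed
      have "(\<Sum>(x, k)\<in>\<D>. measure lborel k *\<^sub>R g x) - (f b - f a)
          = (\<Sum>(x, k)\<in>\<D>. measure lborel k *\<^sub>R g x - (f (Sup k) - f (Inf k)))"
        unfolding additive_tagged_division_1[OF \<open>a \<le> b\<close> D(1), of f, symmetric]
        by (simp add: sum_subtractf case_prod_unfold)
      also have "norm \<dots> \<le> (\<Sum>(x, k)\<in>\<D>. norm (measure lborel k *\<^sub>R g x - (f (Sup k) - f (Inf k))))"
        by (rule order_trans[OF norm_sum]) (simp add: case_prod_unfold)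
      also have "\<dots> \<le> (\<Sum>(x, k)\<in>\<D>. \<eta> * measure lborel k
          + (if (x, k) \<in> DN then norm (f (Sup k) - f (Inf k)) else 0))"
        by (rule sum_mono) (use tag_bound in auto)
      also have "\<dots> = \<eta> * (\<Sum>(x, k)\<in>\<D>. measure lborel k)
          + (\<Sum>xk\<in>\<D>. if xk \<in> DN then norm (f (Sup (snd xk)) - f (Inf (snd xk))) else 0)"
        by (simp add: sum.distrib case_prod_unfold sum_distrib_left)
      also have "(\<Sum>(x, k)\<in>\<D>. measure lborel k) = b - a"
        using additive_content_tagged_division[of \<D> a b] D(1) \<open>a \<le> b\<close> by simp
      also have "(\<Sum>xk\<in>\<D>. if xk \<in> DN then norm (f (Sup (snd xk)) - f (Inf (snd xk))) else 0)
          = (\<Sum>(x, k)\<in>DN. norm (f (Sup k) - f (Inf k)))"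
        using Dp(1) by (simp add: sum.If_cases case_prod_unfold DN_def Int_def)
      also have "\<eta> * (b - a) \<le> \<epsilon> / 2"
        using \<open>a \<le> b\<close> \<open>\<epsilon> > 0\<close> by (simp add: \<eta>_def field_simps)
      finally show "norm ((\<Sum>(x, k)\<in>\<D>. measure lborel k *\<^sub>R g x) - (f b - f a)) < \<epsilon>"
        using bad by linarith
    qed
  qed
  then show ?thesis
    by (rule has_integral_spike[OF N, rotated]) (auto simp: g_def)
qed

text \<open>Intervals with disjoint interiors form a division of their union, so the left-hand side is the
  integral over a subset of \<open>{a..b}\<close>. The family \<open>I\<close> has the form used to define absolute
  continuity.\<close>

lemma sum_integral_disjoint_le:
  fixes g :: "real \<Rightarrow> real"
  assumes g: "g integrable_on {a..b}" "\<And>x. x \<in> {a..b} \<Longrightarrow> 0 \<le> g x"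
    and I: "finite I" "\<And>s t. (s, t) \<in> I \<Longrightarrow> a \<le> s \<and> s < t \<and> t \<le> b"
      "disjoint_family_on (\<lambda>(s, t). {s<..<t}) I"
  shows "(\<Sum>(s, t)\<in>I. integral {s..t} g) \<le> integral {a..b} g"
proof -
  define J where "J = (\<lambda>(s, t). {s..t}) ` I"
  have inj: "inj_on (\<lambda>(s, t). {s..t}) I"
    by (rule inj_onI) (use I(2) in \<open>force simp: Icc_eq_Icc\<close>)
  have div: "J division_of (\<Union>J)"
  proof (rule division_ofI)
    show "finite J" using I(1) by (simp add: J_def)
    fix k assume k: "k \<in> J"
    then obtain s t where st: "(s, t) \<in> I" "k = {s..t}" by (auto simp: J_def)
    show "k \<subseteq> \<Union>J" using k by blast
    show "k \<noteq> {}" using st I(2)[OF st(1)] by simp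
    show "\<exists>a b. k = cbox a b" using st by (auto simp: cbox_interval)
    fix l assume l: "l \<in> J" "k \<noteq> l"
    then obtain s' t' where st': "(s', t') \<in> I" "l = {s'..t'}" by (auto simp: J_def)
    have "(s, t) \<noteq> (s', t')" using st st' l(2) by auto
    then have "{s<..<t} \<inter> {s'<..<t'} = {}"
      using I(3) st(1) st'(1) unfolding disjoint_family_on_def by fastforce
    then show "interior k \<inter> interior l = {}"
      using st st' by (simp add: interior_atLeastAtMost_real)
  qed auto
  have sub: "\<Union>J \<subseteq> {a..b}" using I(2) by (force simp: J_def)
  have "(\<Sum>(s, t)\<in>I. integral {s..t} g) = (\<Sum>k\<in>J. integral k g)"
    unfolding J_def by (subst sum.reindex[OF inj]) (simp add: case_prod_unfold comp_def)
  also have "\<dots> = integral (\<Union>J) g"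
    by (rule integral_combine_division_topdown[symmetric])
      (use div sub g(1) integrable_on_subdivision in blast)+
  also have "\<dots> \<le> integral {a..b} g"
    by (rule integral_subset_le[OF sub _ g(1)])
      (use div sub g integrable_on_subdivision in blast)+
  finally show ?thesis .
qed

text \<open>Truncation: \<open>|f| \<le> (|f| - n)\<^sup>+ + n\<close>, where the first summand has small integral for large \<open>n\<close> by
  dominated convergence, and the second contributes \<open>n\<close> times the total length.\<close>

lemma absolutely_continuous_on_indefinite_integral:
  fixes f :: "real \<Rightarrow> 'a::euclidean_space"
  assumes f: "f absolutely_integrable_on {a..b}"
  shows "absolutely_continuous_on a b (\<lambda>x. integral {a..x} f)"
  unfolding absolutely_continuous_on_def
proof (intro allI impI)
  fix \<epsilon> :: real assume "\<epsilon> > 0"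
  define g where "g n x = max (norm (f x) - real n) 0" for n :: nat and x
  have nf: "(\<lambda>x. norm (f x)) absolutely_integrable_on {a..b}"
    using f by (rule set_integrable_norm)
  have gi: "g n absolutely_integrable_on {a..b}" for n
    unfolding g_def using nf
    by (intro absolutely_integrable_max_1 set_integral_diff absolutely_integrable_on_const) auto
  have "(\<lambda>n. integral {a..b} (g n)) \<longlonglongrightarrow> integral {a..b} (\<lambda>x. 0)"
  proof (rule dominated_convergence(2))
    show "g n integrable_on {a..b}" for n using gi absolutely_integrable_on_def by blast
    show "(\<lambda>x. norm (f x)) integrable_on {a..b}" using nf absolutely_integrable_on_def by blast
    show "norm (g n x) \<le> norm (f x)" for n x by (auto simp: g_def)
    show "(\<lambda>n. g n x) \<longlonglongrightarrow> 0" for x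
    proof (rule tendsto_eventually)
      obtain N where "norm (f x) \<le> real N" using real_arch_simple by blast
      then show "\<forall>\<^sub>F n in sequentially. g n x = 0"
        by (intro eventually_sequentiallyI[of N]) (auto simp: g_def)
    qed
  qed
  then obtain n where n: "integral {a..b} (g n) < \<epsilon> / 2"
    using \<open>\<epsilon> > 0\<close> order_tendstoD(2)[of _ 0 sequentially "\<epsilon> / 2"] eventually_happens[of _ sequentially]
    by fastforce
  define \<delta> where "\<delta> = \<epsilon> / (2 * (real n + 1))"
  have "\<delta> > 0" using \<open>\<epsilon> > 0\<close> by (simp add: \<delta>_def)
  show "\<exists>\<delta>>0. \<forall>I. finite I \<and> (\<forall>(s, t)\<in>I. a \<le> s \<and> s < t \<and> t \<le> b) \<and>
        disjoint_family_on (\<lambda>(s, t). {s<..<t}) I \<and> (\<Sum>(s, t)\<in>I. t - s) < \<delta> \<longrightarrow>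
        (\<Sum>(s, t)\<in>I. norm (integral {a..t} f - integral {a..s} f)) < \<epsilon>"
  proof (intro exI[of _ \<delta>] conjI allI impI \<open>\<delta> > 0\<close>)
    fix I assume I: "finite I \<and> (\<forall>(s, t)\<in>I. a \<le> s \<and> s < t \<and> t \<le> b) \<and>
        disjoint_family_on (\<lambda>(s, t). {s<..<t}) I \<and> (\<Sum>(s, t)\<in>I. t - s) < \<delta>"
    have "norm (integral {a..t} f - integral {a..s} f) \<le> integral {s..t} (g n) + n * (t - s)"
      if st: "(s, t) \<in> I" for s t :: real
    proof -
      have st: "a \<le> s" "s < t" "t \<le> b" using I st by auto
      have fi: "f integrable_on {a..t}" and fi': "f integrable_on {s..t}"
        and gi': "g n integrable_on {s..t}"
        by (rule integrable_on_subinterval[where S="{a..b}"];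
            use f gi[of n] st in \<open>auto simp: absolutely_integrable_on_def\<close>)+
      have "integral {a..t} f - integral {a..s} f = integral {s..t} f"
        using Henstock_Kurzweil_Integration.integral_combine[OF _ _ fi, of s] st
        by (simp add: diff_eq_eq add.commute)
      also have "norm \<dots> \<le> integral {s..t} (\<lambda>x. g n x + n)"
      proof (rule integral_norm_bound_integral[OF fi'])
        show "(\<lambda>x. g n x + n) integrable_on {s..t}"
          using gi' by (intro integrable_add) (auto intro: integrable_const_ivl)
      qed (auto simp: g_def)
      also have "\<dots> = integral {s..t} (g n) + n * (t - s)"
        using gi' st by (subst integral_add) (auto intro: integrable_const_ivl)
      finally show ?thesis .
    qed
    then have "(\<Sum>(s, t)\<in>I. norm (integral {a..t} f - integral {a..s} f))
        \<le> (\<Sum>(s, t)\<in>I. integral {s..t} (g n) + n * (t - s))"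
      by (intro sum_mono) auto
    also have "\<dots> = (\<Sum>(s, t)\<in>I. integral {s..t} (g n)) + n * (\<Sum>(s, t)\<in>I. t - s)"
      by (simp add: sum.distrib case_prod_unfold sum_distrib_left)
    also have "\<dots> \<le> integral {a..b} (g n) + n * \<delta>"
    proof (intro add_mono mult_left_mono sum_integral_disjoint_le)
      show "g n integrable_on {a..b}" using gi absolutely_integrable_on_def by blast
    qed (use I in \<open>auto simp: g_def\<close>)
    also have "n * \<delta> \<le> \<epsilon> / 2"
      using \<open>\<epsilon> > 0\<close> by (simp add: \<delta>_def field_simps)
    finally show "(\<Sum>(s, t)\<in>I. norm (integral {a..t} f - integral {a..s} f)) < \<epsilon>"
      using n by linarith
  qed
qed

section \<open>Differentiation of indefinite integrals\<close>

lemma right_difference_quotient_integral: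
  fixes f :: "real \<Rightarrow> 'a::euclidean_space"
  assumes f: "f integrable_on {a..b}"
  obtains N where "negligible N"
    "\<And>x e. x \<in> {a..<b} - N \<Longrightarrow> e > 0 \<Longrightarrow> \<exists>d>0. \<forall>h. 0 < h \<and> h < d \<longrightarrow>
       norm (integral {x..x + h} f - h *\<^sub>R f x) \<le> e * h"
proof -
  define g where "g x = (if x \<in> {a..b} then f x else 0)" for x
  have gU: "g integrable_on UNIV" using f unfolding g_def integrable_restrict_UNIV .
  have "g integrable_on cbox c d" for c d
    using gU by (rule integrable_on_subcbox) auto
  from integrable_ccontinuous_explicit[OF this] obtain N where N: "negligible N"
    "\<And>x e. \<lbrakk>x \<notin> N; 0 < e\<rbrakk> \<Longrightarrow> \<exists>d>0. \<forall>h. 0 < h \<and> h < d \<longrightarrow>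
       norm (integral (cbox x (x + h *\<^sub>R One)) g /\<^sub>R h ^ DIM(real) - g x) < e" by metis
  show thesis
  proof (rule that[OF N(1)])
    fix x e :: real assume x: "x \<in> {a..<b} - N" and "e > 0"
    then obtain d where "d > 0" and d: "\<And>h. 0 < h \<Longrightarrow> h < d \<Longrightarrow>
       norm (integral {x..x + h} g /\<^sub>R h - g x) < e"
      using N(2)[of x e] by (auto simp: cbox_interval)
    show "\<exists>d>0. \<forall>h. 0 < h \<and> h < d \<longrightarrow> norm (integral {x..x + h} f - h *\<^sub>R f x) \<le> e * h"
    proof (intro exI[of _ "min d (b - x)"] conjI allI impI)
      show "min d (b - x) > 0" using \<open>d > 0\<close> x by auto
      fix h assume h: "0 < h \<and> h < min d (b - x)"
      have "integral {x..x + h} g = integral {x..x + h} f" "g x = f x"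
        using x h by (auto simp: g_def intro!: integral_cong)
      then have *: "norm (integral {x..x + h} f /\<^sub>R h - f x) < e" using d[of h] h by simp
      have "integral {x..x + h} f - h *\<^sub>R f x = h *\<^sub>R (integral {x..x + h} f /\<^sub>R h - f x)"
        using h by (simp add: scaleR_diff_right)
      also have "norm \<dots> \<le> e * h" using * h by (simp add: mult.commute)
      finally show "norm (integral {x..x + h} f - h *\<^sub>R f x) \<le> e * h" .
    qed
  qed
qed

lemma AE_lebesgue_on_iff_negligible:
  assumes "S \<in> sets lebesgue"
  shows "(AE x in lebesgue_on S. P x) \<longleftrightarrow> (\<exists>N. negligible N \<and> (\<forall>x\<in>S - N. P x))"
proof -
  have "(AE x in lebesgue_on S. P x) \<longleftrightarrow> (AE x in lebesgue. x \<in> S \<longrightarrow> P x)"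
    using assms by (subst AE_restrict_space_iff) auto
  also have "\<dots> \<longleftrightarrow> (\<exists>N. negligible N \<and> (\<forall>x\<in>S - N. P x))"
  proof
    assume "AE x in lebesgue. x \<in> S \<longrightarrow> P x"
    then obtain N where N: "{x \<in> space lebesgue. \<not> (x \<in> S \<longrightarrow> P x)} \<subseteq> N" "N \<in> null_sets lebesgue"
      by (auto elim!: AE_E simp: null_sets_def)
    then show "\<exists>N. negligible N \<and> (\<forall>x\<in>S - N. P x)"
      by (intro exI[of _ N]) (auto simp: negligible_iff_null_sets)
  next
    assume "\<exists>N. negligible N \<and> (\<forall>x\<in>S - N. P x)"
    then obtain N where N: "N \<in> null_sets lebesgue" "\<forall>x\<in>S - N. P x"
      by (auto simp: negligible_iff_null_sets)
    then show "AE x in lebesgue. x \<in> S \<longrightarrow> P x"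
      by (intro AE_I'[OF N(1)]) auto
  qed
  finally show ?thesis .
qed

text \<open>Lebesgue's differentiation theorem on the line. Averages over \<open>[x, x + h]\<close> give the right
  derivative; those of the reflected function \<open>x \<mapsto> f (- x)\<close> give the left derivative.\<close>

lemma has_vector_derivative_indefinite_integral_AE:
  fixes f :: "real \<Rightarrow> 'a::euclidean_space"
  assumes f: "f integrable_on {a..b}"
  shows "AE x in lebesgue_on {a..b}. ((\<lambda>x. integral {a..x} f) has_vector_derivative f x) (at x)"
proof -
  obtain N where N: "negligible N"
    "\<And>x e. x \<in> {a..<b} - N \<Longrightarrow> e > 0 \<Longrightarrow> \<exists>d>0. \<forall>h. 0 < h \<and> h < d \<longrightarrow>
       norm (integral {x..x + h} f - h *\<^sub>R f x) \<le> e * h"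
    using right_difference_quotient_integral[OF f] by blast
  have "(\<lambda>x. f (- x)) integrable_on {- b..- a}"
    using f by (simp add: integrable_reflect_real)
  then obtain N' where N': "negligible N'"
    "\<And>x e. x \<in> {-b..<-a} - N' \<Longrightarrow> e > 0 \<Longrightarrow> \<exists>d>0. \<forall>h. 0 < h \<and> h < d \<longrightarrow>
       norm (integral {x..x + h} (\<lambda>x. f (- x)) - h *\<^sub>R f (- x)) \<le> e * h"
    using right_difference_quotient_integral by blast
  define M where "M = N \<union> uminus ` N' \<union> {a, b}"
  have "negligible (uminus ` N')"
    by (rule negligible_differentiable_image_negligible[OF _ N'(1)])
      (auto intro: derivative_intros)
  then have "negligible M" using N(1) unfolding M_def by (intro negligible_Un) auto
  moreover have "((\<lambda>x. integral {a..x} f) has_vector_derivative f x) (at x)"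
    if x: "x \<in> {a..b} - M" for x
    unfolding has_vector_derivative_def has_derivative_at_alt
  proof (intro conjI allI impI bounded_linear_scaleR_left)
    fix e :: real assume "e > 0"
    have xN: "x \<in> {a..<b} - N" and xN': "- x \<in> {-b..<-a} - N'" and ab: "a < x" "x < b"
      using x by (auto simp: M_def image_iff)
    obtain d1 where d1: "d1 > 0" "\<And>h. 0 < h \<Longrightarrow> h < d1 \<Longrightarrow>
        norm (integral {x..x + h} f - h *\<^sub>R f x) \<le> e * h"
      using N(2)[OF xN \<open>e > 0\<close>] by blast
    obtain d2 where d2: "d2 > 0" "\<And>h. 0 < h \<Longrightarrow> h < d2 \<Longrightarrow>
        norm (integral {- x..- x + h} (\<lambda>x. f (- x)) - h *\<^sub>R f x) \<le> e * h"
      using N'(2)[OF xN' \<open>e > 0\<close>] by auto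
    have fi: "f integrable_on {a..t}" if "t \<le> b" for t
      by (rule integrable_on_subinterval[OF f]) (use that in auto)
    show "\<exists>d>0. \<forall>y. norm (y - x) < d \<longrightarrow>
        norm (integral {a..y} f - integral {a..x} f - (y - x) *\<^sub>R f x) \<le> e * norm (y - x)"
    proof (intro exI[of _ "min (min d1 d2) (min (x - a) (b - x))"] conjI allI impI)
      show "min (min d1 d2) (min (x - a) (b - x)) > 0" using ab d1(1) d2(1) by simp
      fix y assume y: "norm (y - x) < min (min d1 d2) (min (x - a) (b - x))"
      consider "y = x" | "x < y" | "y < x" by linarith
      then show "norm (integral {a..y} f - integral {a..x} f - (y - x) *\<^sub>R f x) \<le> e * norm (y - x)"
      proof cases
        case 2
        have "integral {a..x} f + integral {x..y} f = integral {a..y} f"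
          by (rule Henstock_Kurzweil_Integration.integral_combine) (use ab 2 y fi in auto)
        then have "integral {a..y} f - integral {a..x} f = integral {x..y} f"
          by (metis add_diff_cancel_left')
        then show ?thesis using d1(2)[of "y - x"] 2 y by simp
      next
        case 3
        have "integral {a..y} f + integral {y..x} f = integral {a..x} f"
          by (rule Henstock_Kurzweil_Integration.integral_combine) (use ab 3 y fi in auto)
        moreover have "integral {- x..- y} (\<lambda>x. f (- x)) = integral {y..x} f"
          using integral_reflect[of x y f] by (simp add: cbox_interval)
        ultimately have "integral {a..y} f - integral {a..x} f - (y - x) *\<^sub>R f x
            = - (integral {- x..- x + (x - y)} (\<lambda>x. f (- x)) - (x - y) *\<^sub>R f x)"
          by (simp add: algebra_simps)
        also have "norm \<dots> \<le> e * (x - y)"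
          unfolding norm_minus_cancel using d2(2)[of "x - y"] 3 y by simp
        finally show ?thesis using 3 by simp
      qed auto
    qed
  qed
  ultimately show ?thesis by (subst AE_lebesgue_on_iff_negligible) auto
qed

section \<open>The first-order system for a mode and its flux\<close>

lemma absolutely_continuous_on_has_integral:
  fixes f :: "real \<Rightarrow> 'a::euclidean_space"
  assumes ac: "absolutely_continuous_on a b f"
    and der: "AE x in lebesgue_on {a..b}. (f has_vector_derivative f' x) (at x)"
    and cd: "a \<le> c" "c \<le> d" "d \<le> b"
  shows "(f' has_integral (f d - f c)) {c..d}"
proof -
  obtain N where "negligible N" "\<And>x. x \<in> {a..b} - N \<Longrightarrow> (f has_vector_derivative f' x) (at x)"
    using der by (auto simp: AE_lebesgue_on_iff_negligible)
  then show ?thesis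
    using cd by (intro fundamental_theorem_of_calculus_absolutely_continuous
        [OF absolutely_continuous_on_subinterval[OF ac cd(1,3)] cd(2)]) auto
qed

lemma absolutely_continuous_on_real_mono:
  fixes f :: "real \<Rightarrow> real"
  assumes ac: "absolutely_continuous_on a b f"
    and der: "AE x in lebesgue_on {a..b}. (f has_vector_derivative f' x) (at x)"
    and nn: "\<And>x. x \<in> {c..d} \<Longrightarrow> 0 \<le> f' x"
    and cd: "a \<le> c" "c \<le> d" "d \<le> b"
  shows "f c \<le> f d"
  using has_integral_nonneg[OF absolutely_continuous_on_has_integral[OF ac der cd] nn] by simp

text \<open>The system \<open>w' = r p\<close>, \<open>p' = q w\<close> in the sense of Caratheodory. It is equivalent to
  \<open>((1/r) w')' = q w\<close>, but refers to no derivative of \<open>r\<close> or \<open>q\<close>.\<close>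

definition flux_system ::
  "(real \<Rightarrow> real) \<Rightarrow> (real \<Rightarrow> real) \<Rightarrow> (real \<Rightarrow> 'a::real_normed_vector) \<Rightarrow> (real \<Rightarrow> 'a) \<Rightarrow> bool" where
  "flux_system r q w p \<longleftrightarrow> absolutely_continuous_on 0 1 w \<and> absolutely_continuous_on 0 1 p \<and>
     (AE x in lebesgue_on {0..1}.
        (w has_vector_derivative r x *\<^sub>R p x) (at x) \<and> (p has_vector_derivative q x *\<^sub>R w x) (at x))"

lemma flux_system_add:
  assumes "flux_system r q w p" "flux_system r q v \<sigma>"
  shows "flux_system r q (\<lambda>x. w x + v x) (\<lambda>x. p x + \<sigma> x)"
proof -
  have "AE x in lebesgue_on {0..1}.
      ((\<lambda>x. w x + v x) has_vector_derivative r x *\<^sub>R (p x + \<sigma> x)) (at x) \<and>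
      ((\<lambda>x. p x + \<sigma> x) has_vector_derivative q x *\<^sub>R (w x + v x)) (at x)"
  proof -
    have "AE x in lebesgue_on {0..1}.
      (w has_vector_derivative r x *\<^sub>R p x) (at x) \<and> (p has_vector_derivative q x *\<^sub>R w x) (at x)"
      "AE x in lebesgue_on {0..1}.
      (v has_vector_derivative r x *\<^sub>R \<sigma> x) (at x) \<and> (\<sigma> has_vector_derivative q x *\<^sub>R v x) (at x)"
      using assms by (auto simp: flux_system_def)
    then show ?thesis
      by eventually_elim (auto simp: scaleR_add_right intro: has_vector_derivative_add)
  qed
  then show ?thesis
    using assms unfolding flux_system_def by (auto intro: absolutely_continuous_on_add)
qed

lemma flux_system_bounded_linear:
  assumes T: "bounded_linear T" and sys: "flux_system r q w p"
  shows "flux_system r q (\<lambda>x. T (w x)) (\<lambda>x. T (p x))"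
proof -
  have "AE x in lebesgue_on {0..1}.
      (w has_vector_derivative r x *\<^sub>R p x) (at x) \<and> (p has_vector_derivative q x *\<^sub>R w x) (at x)"
    using sys by (auto simp: flux_system_def)
  then have "AE x in lebesgue_on {0..1}.
      ((\<lambda>x. T (w x)) has_vector_derivative r x *\<^sub>R T (p x)) (at x) \<and>
      ((\<lambda>x. T (p x)) has_vector_derivative q x *\<^sub>R T (w x)) (at x)"
    by eventually_elim
      (metis bounded_linear.has_vector_derivative[OF T] linear_scale[OF bounded_linear.linear[OF T]])
  then show ?thesis
    using sys unfolding flux_system_def by (auto intro: absolutely_continuous_on_bounded_linear[OF T])
qed

context
  fixes r q :: "real \<Rightarrow> real"
  assumes r_nonneg: "\<And>x. 0 \<le> r x" and q_nonneg: "\<And>x. 0 \<le> q x"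
begin

text \<open>Maximum principle. As \<open>g = w \<bullet> p\<close> is nondecreasing and \<open>(|w|\<^sup>2)' = 2 r g\<close>, the function \<open>|w|\<^sup>2\<close> is
  nonincreasing on \<open>[0, x]\<close> if \<open>g(x) \<le> 0\<close>, and nondecreasing on \<open>[x, 1]\<close> otherwise.\<close>

lemma flux_system_norm_le:
  fixes w p :: "real \<Rightarrow> 'a::euclidean_space"
  assumes sys: "flux_system r q w p" and x: "x \<in> {0..1}"
  shows "norm (w x) \<le> max (norm (w 0)) (norm (w 1))"
proof -
  define g where "g x = w x \<bullet> p x" for x
  define F where "F x = w x \<bullet> w x" for x
  have acw: "absolutely_continuous_on 0 1 w" and acp: "absolutely_continuous_on 0 1 p"
    and der: "AE x in lebesgue_on {0..1}.
      (w has_vector_derivative r x *\<^sub>R p x) (at x) \<and> (p has_vector_derivative q x *\<^sub>R w x) (at x)"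
    using sys by (auto simp: flux_system_def)
  have acg: "absolutely_continuous_on 0 1 g" and acF: "absolutely_continuous_on 0 1 F"
    unfolding g_def F_def
    by (intro absolutely_continuous_on_bounded_bilinear[OF bounded_bilinear_inner] acw acp)+
  have dg: "AE x in lebesgue_on {0..1}.
      (g has_vector_derivative q x * (w x \<bullet> w x) + r x * (p x \<bullet> p x)) (at x)"
    using der
  proof eventually_elim
    case (elim x)
    then show ?case
      using bounded_bilinear.has_vector_derivative[OF bounded_bilinear_inner,
          of w "r x *\<^sub>R p x" x UNIV p "q x *\<^sub>R w x"]
      by (simp add: g_def[abs_def])
  qed
  have dF: "AE x in lebesgue_on {0..1}. (F has_vector_derivative 2 * r x * g x) (at x)"
    using der
  proof eventually_elim
    case (elim x)
    then show ?case
      using bounded_bilinear.has_vector_derivative[OF bounded_bilinear_inner,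
          of w "r x *\<^sub>R p x" x UNIV w "r x *\<^sub>R p x"]
      by (simp add: F_def[abs_def] g_def inner_commute algebra_simps)
  qed
  have gmono: "g c \<le> g d" if "0 \<le> c" "c \<le> d" "d \<le> 1" for c d
    using that r_nonneg q_nonneg by (intro absolutely_continuous_on_real_mono[OF acg dg]) auto
  have "F x \<le> F 0 \<or> F x \<le> F 1"
  proof (cases "g x \<le> 0")
    case True
    have "((\<lambda>y. - (2 * r y * g y)) has_integral - (F x - F 0)) {0..x}"
      using x by (intro has_integral_neg absolutely_continuous_on_has_integral[OF acF dF]) auto
    moreover have "0 \<le> - (2 * r y * g y)" if "y \<in> {0..x}" for y
      using gmono[of y x] that x True r_nonneg[of y] by (simp add: mult_nonneg_nonpos)
    ultimately have "0 \<le> - (F x - F 0)" by (rule has_integral_nonneg)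
    then show ?thesis by simp
  next
    case False
    have "2 * r y * g y \<ge> 0" if "y \<in> {x..1}" for y
      using gmono[of x y] that x False r_nonneg[of y] by (intro mult_nonneg_nonneg) auto
    then have "F x \<le> F 1"
      using x by (intro absolutely_continuous_on_real_mono[OF acF dF]) auto
    then show ?thesis ..
  qed
  then show ?thesis by (auto simp: F_def norm_le le_max_iff_disj)
qed

text \<open>Uniqueness. By the maximum principle \<open>w\<close> vanishes, so \<open>p\<close> is constant; at a point where \<open>r > 0\<close>
  and \<open>0 = w' = r p\<close> this constant is \<open>0\<close>.\<close>

lemma flux_system_zero_boundary:
  fixes w p :: "real \<Rightarrow> 'a::euclidean_space"
  assumes sys: "flux_system r q w p" and bd: "w 0 = 0" "w 1 = 0"
    and r_pos: "AE x in lebesgue_on {0..1}. 0 < r x" and x: "x \<in> {0..1}"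
  shows "w x = 0" "p x = 0"
proof -
  have w0: "w x = 0" if "x \<in> {0..1}" for x
    using flux_system_norm_le[OF sys that] bd by simp
  then show "w x = 0" using x .
  have acw: "absolutely_continuous_on 0 1 w" and acp: "absolutely_continuous_on 0 1 p"
    and der: "AE x in lebesgue_on {0..1}.
      (w has_vector_derivative r x *\<^sub>R p x) (at x) \<and> (p has_vector_derivative q x *\<^sub>R w x) (at x)"
    using sys by (auto simp: flux_system_def)
  have "AE x in lebesgue_on {0..1}. (w has_vector_derivative r x *\<^sub>R p x) (at x) \<and> 0 < r x"
    using der r_pos by eventually_elim auto
  then have "\<exists>N. negligible N \<and>
      (\<forall>x\<in>{0..1} - N. (w has_vector_derivative r x *\<^sub>R p x) (at x) \<and> 0 < r x)"
    by (rule AE_lebesgue_on_iff_negligible[THEN iffD1, rotated]) simp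
  then obtain N where N: "negligible N"
    "\<And>x. x \<in> {0..1} - N \<Longrightarrow> (w has_vector_derivative r x *\<^sub>R p x) (at x)"
    "\<And>x. x \<in> {0..1} - N \<Longrightarrow> 0 < r x"
    by blast
  have const: "p d = p c" if "0 \<le> c" "c \<le> d" "d \<le> 1" for c d
  proof -
    have "((\<lambda>x. q x *\<^sub>R w x) has_integral (p d - p c)) {c..d}"
      by (rule absolutely_continuous_on_has_integral[OF acp]) (use der that in auto)
    moreover have "((\<lambda>x. q x *\<^sub>R w x) has_integral 0) {c..d}"
      by (rule has_integral_is_0) (use w0 that in auto)
    ultimately have "p d - p c = 0" by (rule has_integral_unique)
    then show ?thesis by simp
  qed
  have "\<not> {0<..<1::real} \<subseteq> N"
    using negligible_subset[of N "{0<..<1}"] N(1) open_not_negligible[of "{0<..<1::real}"] by auto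
  then obtain z where z: "z \<in> {0<..<1}" "z \<notin> N" by blast
  have "(w has_vector_derivative r z *\<^sub>R p z) (at z)" using N(2) z by auto
  moreover have "(w has_vector_derivative 0) (at z)"
    by (rule has_vector_derivative_transform_within_open[of "\<lambda>_. 0" _ _ "{0<..<1}"])
      (use w0 z in auto)
  ultimately have "r z *\<^sub>R p z = 0" by (rule vector_derivative_unique_at)
  then have "p z = 0" using N(3)[of z] z by auto
  then show "p x = 0" using const[of x z] const[of z x] z x by (cases "x \<le> z") auto
qed

text \<open>Two facts confine \<open>p\<close>: it varies by at most \<open>\<integral> q |w| \<le> Q B\<close>, and its mean with respect to the
  density \<open>r\<close> is \<open>(w(1) - w(0)) / R\<close>, of norm at most \<open>2 B / R\<close>.\<close>

lemma flux_system_flux_bound: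
  fixes w p :: "real \<Rightarrow> 'a::euclidean_space"
  assumes sys: "flux_system r q w p" and bd: "norm (w 0) \<le> B" "norm (w 1) \<le> B"
    and r_int: "(r has_integral R) {0..1}" and q_int: "(q has_integral Q) {0..1}" and R: "0 < R"
    and x: "x \<in> {0..1}"
  shows "norm (p x) \<le> (Q + 2 / R) * B"
proof -
  have wB: "norm (w x) \<le> B" if "x \<in> {0..1}" for x
    using flux_system_norm_le[OF sys that] bd by simp
  have "B \<ge> 0" using bd(1) norm_ge_zero order_trans by blast
  have acw: "absolutely_continuous_on 0 1 w" and acp: "absolutely_continuous_on 0 1 p"
    and der: "AE x in lebesgue_on {0..1}. (w has_vector_derivative r x *\<^sub>R p x) (at x)"
      "AE x in lebesgue_on {0..1}. (p has_vector_derivative q x *\<^sub>R w x) (at x)"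
    using sys by (auto simp: flux_system_def)
  have osc: "norm (p d - p c) \<le> Q * B" if cd: "0 \<le> c" "c \<le> d" "d \<le> 1" for c d
  proof -
    have i: "((\<lambda>x. q x *\<^sub>R w x) has_integral (p d - p c)) {c..d}"
      by (rule absolutely_continuous_on_has_integral[OF acp der(2)]) (use cd in auto)
    have qi: "q integrable_on {c..d}"
      by (rule integrable_on_subinterval[of _ "{0..1}"]) (use q_int cd in auto)
    have "norm (integral {c..d} (\<lambda>x. q x *\<^sub>R w x)) \<le> integral {c..d} (\<lambda>x. q x * B)"
    proof (rule integral_norm_bound_integral)
      show "(\<lambda>x. q x *\<^sub>R w x) integrable_on {c..d}" using i by blast
      show "(\<lambda>x. q x * B) integrable_on {c..d}" using qi by (rule integrable_on_mult_left)
      show "norm (q x *\<^sub>R w x) \<le> q x * B" if "x \<in> {c..d}" for x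
        using wB[of x] that cd q_nonneg[of x] by (auto intro: mult_left_mono)
    qed
    also have "\<dots> = integral {c..d} q * B" by (rule integral_mult_left)
    also have "integral {c..d} q \<le> integral {0..1} q"
      by (rule integral_subset_le) (use cd qi q_int q_nonneg in auto)
    then have "integral {c..d} q * B \<le> Q * B"
      using q_int \<open>B \<ge> 0\<close> by (auto intro!: mult_right_mono simp: integral_unique)
    finally show ?thesis using i by (simp add: integral_unique)
  qed
  have osc': "norm (p x - p y) \<le> Q * B" if "y \<in> {0..1}" for y
    using osc[of x y] osc[of y x] that x by (cases "x \<le> y") (auto simp: norm_minus_commute)
  have "((\<lambda>y. r y *\<^sub>R p y) has_integral (w 1 - w 0)) {0..1}"
    by (rule absolutely_continuous_on_has_integral[OF acw der(1)]) auto
  moreover have "((\<lambda>y. r y *\<^sub>R p x) has_integral R *\<^sub>R p x) {0..1}"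
    using r_int by (rule has_integral_scaleR_left)
  ultimately have i: "((\<lambda>y. r y *\<^sub>R (p x - p y)) has_integral (R *\<^sub>R p x - (w 1 - w 0))) {0..1}"
    unfolding scaleR_diff_right by (intro has_integral_diff)
  have "norm (integral {0..1} (\<lambda>y. r y *\<^sub>R (p x - p y))) \<le> integral {0..1} (\<lambda>y. r y * (Q * B))"
  proof (rule integral_norm_bound_integral)
    show "(\<lambda>y. r y *\<^sub>R (p x - p y)) integrable_on {0..1}" using i by blast
    show "(\<lambda>y. r y * (Q * B)) integrable_on {0..1}" using r_int by (intro integrable_on_mult_left) auto
    show "norm (r y *\<^sub>R (p x - p y)) \<le> r y * (Q * B)" if "y \<in> {0..1}" for y
      using osc'[OF that] r_nonneg[of y] by (auto intro: mult_left_mono)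
  qed
  then have "norm (R *\<^sub>R p x - (w 1 - w 0)) \<le> R * (Q * B)"
    using i r_int by (simp add: integral_unique)
  moreover have "norm (R *\<^sub>R p x) \<le> norm (R *\<^sub>R p x - (w 1 - w 0)) + norm (w 1 - w 0)"
    using norm_triangle_ineq[of "R *\<^sub>R p x - (w 1 - w 0)" "w 1 - w 0"] by simp
  moreover have "norm (w 1 - w 0) \<le> 2 * B" using norm_triangle_ineq4[of "w 1" "w 0"] bd by simp
  ultimately have "R * norm (p x) \<le> R * (Q * B) + 2 * B"
    using R by simp
  also have "\<dots> = R * ((Q + 2 / R) * B)" using R by (simp add: field_simps)
  finally have "R * norm (p x) \<le> R * ((Q + 2 / R) * B)" .
  then show ?thesis using R by simp
qed

end

section \<open>Initial and boundary value problems for the system\<close>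

lemma absolutely_integrable_times_continuous:
  fixes r f :: "real \<Rightarrow> real"
  assumes r: "r integrable_on {a..b}" "\<And>x. 0 \<le> r x" and f: "continuous_on {a..b} f"
  shows "(\<lambda>x. r x * f x) absolutely_integrable_on {a..b}"
proof -
  have "(\<lambda>x. f x * r x) absolutely_integrable_on {a..b}"
  proof (rule absolutely_integrable_bounded_measurable_product_real)
    show "f \<in> borel_measurable (lebesgue_on {a..b})"
      using f by (rule continuous_imp_measurable_on_sets_lebesgue) auto
    show "bounded (f ` {a..b})" using f by (intro compact_imp_bounded compact_continuous_image) auto
    show "r absolutely_integrable_on {a..b}"
      using r by (intro nonnegative_absolutely_integrable_1)
  qed auto
  then show ?thesis by (simp add: mult.commute)
qed

primrec picard_iterate ::
  "real \<Rightarrow> real \<Rightarrow> (real \<Rightarrow> real) \<Rightarrow> (real \<Rightarrow> real) \<Rightarrow> nat \<Rightarrow>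
     (real \<Rightarrow> real) \<times> (real \<Rightarrow> real)" where
  "picard_iterate a b r q 0 = (\<lambda>x. 0, \<lambda>x. 0)"
| "picard_iterate a b r q (Suc k) =
     (\<lambda>x. a + integral {0..x} (\<lambda>t. r t * snd (picard_iterate a b r q k) t),
      \<lambda>x. b + integral {0..x} (\<lambda>t. q t * fst (picard_iterate a b r q k) t))"

text \<open>The function \<open>exp (\<integral> f)\<close> solves \<open>y' = f y\<close>. With \<open>f = r + q\<close> and a constant factor it is the
  majorant of the Picard iterates.\<close>

lemma exp_integral_has_integral:
  fixes f :: "real \<Rightarrow> real"
  assumes f: "f integrable_on {0..1}" "\<And>x. 0 \<le> f x" and x: "x \<in> {0..1}"
  shows "((\<lambda>t. f t * exp (integral {0..t} f)) has_integral (exp (integral {0..x} f) - 1)) {0..x}"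
proof -
  define \<Phi> where "\<Phi> t = integral {0..t} f" for t
  have fabs: "f absolutely_integrable_on {0..1}"
    using f by (intro nonnegative_absolutely_integrable_1)
  have ac\<Phi>: "absolutely_continuous_on 0 1 \<Phi>"
    using absolutely_continuous_on_indefinite_integral[OF fabs] by (simp add: \<Phi>_def[abs_def])
  have \<Phi>_le: "\<Phi> t \<le> \<Phi> 1" if "t \<le> 1" for t
    unfolding \<Phi>_def by (rule integral_subset_le) (use f that integrable_on_subinterval[OF f(1)] in auto)
  have "absolutely_continuous_on 0 1 (\<lambda>t. exp (\<Phi> t))"
  proof (rule absolutely_continuous_on_dominated[OF ac\<Phi> ac\<Phi>])
    fix s t :: real assume "0 \<le> s" "s < t" "t \<le> 1"
    have *: "exp u - exp v \<le> exp u * (u - v)" for u v :: real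
      using exp_ge_add_one_self[of "v - u"] by (simp add: exp_diff field_simps)
    have "\<bar>exp (\<Phi> t) - exp (\<Phi> s)\<bar> \<le> exp (\<Phi> 1) * \<bar>\<Phi> t - \<Phi> s\<bar>"
    proof (cases "\<Phi> s \<le> \<Phi> t")
      case True
      have "exp (\<Phi> t) - exp (\<Phi> s) \<le> exp (\<Phi> 1) * (\<Phi> t - \<Phi> s)"
        using *[of "\<Phi> t" "\<Phi> s"] \<Phi>_le[of t] True \<open>t \<le> 1\<close>
        by (smt (verit, best) exp_le_cancel_iff mult_right_mono)
      then show ?thesis using True by simp
    next
      case False
      have "exp (\<Phi> s) - exp (\<Phi> t) \<le> exp (\<Phi> 1) * (\<Phi> s - \<Phi> t)"
        using *[of "\<Phi> s" "\<Phi> t"] \<Phi>_le[of s] False \<open>s < t\<close> \<open>t \<le> 1\<close>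
        by (smt (verit, best) exp_le_cancel_iff mult_right_mono)
      then show ?thesis using False by simp
    qed
    also have "\<dots> \<le> exp (\<Phi> 1) * (norm (\<Phi> t - \<Phi> s) + norm (\<Phi> t - \<Phi> s))"
      by (intro mult_left_mono) auto
    finally show "norm (exp (\<Phi> t) - exp (\<Phi> s)) \<le> \<dots>" by simp
  qed
  moreover have "AE t in lebesgue_on {0..1}. ((\<lambda>t. exp (\<Phi> t)) has_vector_derivative f t * exp (\<Phi> t)) (at t)"
    using has_vector_derivative_indefinite_integral_AE[OF f(1)]
  proof eventually_elim
    case (elim t)
    then have "(\<Phi> has_real_derivative f t) (at t)"
      by (simp add: \<Phi>_def[abs_def] has_real_derivative_iff_has_vector_derivative)
    then have "((\<lambda>t. exp (\<Phi> t)) has_real_derivative f t * exp (\<Phi> t)) (at t)"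
      by (auto intro!: derivative_eq_intros)
    then show ?case by (simp add: has_real_derivative_iff_has_vector_derivative)
  qed
  ultimately have "((\<lambda>t. f t * exp (\<Phi> t)) has_integral (exp (\<Phi> x) - exp (\<Phi> 0))) {0..x}"
    by (rule absolutely_continuous_on_has_integral) (use x in auto)
  then show ?thesis by (simp add: \<Phi>_def)
qed

text \<open>With nonnegative coefficients and initial values the Picard iterates started at \<open>0\<close> increase, and
  induction keeps them below \<open>E = (a + b) exp (\<integral> (r + q))\<close>. So they converge pointwise, and monotone
  convergence passes to the limit in the integral equations.\<close>

lemma flux_system_initial_value:
  fixes r q :: "real \<Rightarrow> real" and a b :: real
  assumes r: "r integrable_on {0..1}" "\<And>x. 0 \<le> r x"
    and q: "q integrable_on {0..1}" "\<And>x. 0 \<le> q x" and ab: "0 \<le> a" "0 \<le> b"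
  obtains w p where "flux_system r q w p" "w 0 = a" "p 0 = b"
proof -
  define W where "W k = fst (picard_iterate a b r q k)" for k
  define P where "P k = snd (picard_iterate a b r q k)" for k
  define E where "E x = (a + b) * exp (integral {0..x} (\<lambda>t. r t + q t))" for x
  have W0: "W 0 x = 0" and P0: "P 0 x = 0" for x by (auto simp: W_def P_def)
  have WS: "W (Suc k) x = a + integral {0..x} (\<lambda>t. r t * P k t)" for k x by (simp add: W_def P_def)
  have PS: "P (Suc k) x = b + integral {0..x} (\<lambda>t. q t * W k t)" for k x by (simp add: W_def P_def)
  have rq: "(\<lambda>t. r t + q t) integrable_on {0..1}" using r q by (intro integrable_add)
  have "continuous_on {0..1} (W k) \<and> continuous_on {0..1} (P k)" for k
  proof (induction k)
    case 0
    then show ?case by (simp add: W_def P_def)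
  next
    case (Suc k)
    have "(\<lambda>t. r t * P k t) integrable_on {0..1}" "(\<lambda>t. q t * W k t) integrable_on {0..1}"
      using absolutely_integrable_times_continuous[OF r] absolutely_integrable_times_continuous[OF q] Suc
      by (auto simp: absolutely_integrable_on_def)
    then show ?case unfolding WS PS
      by (intro conjI continuous_intros indefinite_integral_continuous_1)
  qed
  then have rP: "(\<lambda>t. r t * P k t) integrable_on {0..1}"
    and qW: "(\<lambda>t. q t * W k t) integrable_on {0..1}" for k
    using absolutely_integrable_times_continuous[OF r] absolutely_integrable_times_continuous[OF q]
    by (auto simp: absolutely_integrable_on_def)
  have rPx: "(\<lambda>t. r t * P k t) integrable_on {0..x}"
    and qWx: "(\<lambda>t. q t * W k t) integrable_on {0..x}" if "x \<in> {0..1}" for k x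
    using that by (auto intro!: integrable_on_subinterval[OF rP] integrable_on_subinterval[OF qW])
  have Ei: "((\<lambda>t. (r t + q t) * E t) has_integral (E x - (a + b))) {0..x}" if "x \<in> {0..1}" for x
    using has_integral_mult_right[OF exp_integral_has_integral[OF rq _ that], of "a + b"] r(2) q(2)
    by (simp add: E_def algebra_simps)
  have E_nonneg: "0 \<le> E x" for x using ab by (simp add: E_def)
  have bound: "\<forall>x\<in>{0..1}. 0 \<le> W k x \<and> W k x \<le> E x \<and> 0 \<le> P k x \<and> P k x \<le> E x" for k
  proof (induction k)
    case 0
    then show ?case using E_nonneg by (simp add: W0 P0)
  next
    case (Suc k)
    show ?case
    proof
      fix x :: real assume x: "x \<in> {0..1}"
      have "integral {0..x} (\<lambda>t. r t * P k t) \<le> integral {0..x} (\<lambda>t. (r t + q t) * E t)"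
        "integral {0..x} (\<lambda>t. q t * W k t) \<le> integral {0..x} (\<lambda>t. (r t + q t) * E t)"
        using Suc x r(2) q(2) E_nonneg
        by (auto intro!: integral_le rPx qWx mult_mono add_nonneg_nonneg has_integral_integrable[OF Ei[OF x]])
      moreover have "0 \<le> integral {0..x} (\<lambda>t. r t * P k t)" "0 \<le> integral {0..x} (\<lambda>t. q t * W k t)"
        using Suc x r(2) q(2) by (auto intro!: integral_nonneg rPx qWx mult_nonneg_nonneg)
      ultimately show "0 \<le> W (Suc k) x \<and> W (Suc k) x \<le> E x \<and> 0 \<le> P (Suc k) x \<and> P (Suc k) x \<le> E x"
        using ab integral_unique[OF Ei[OF x]] by (simp add: WS PS)
    qed
  qed
  have mono: "\<forall>x\<in>{0..1}. W k x \<le> W (Suc k) x \<and> P k x \<le> P (Suc k) x" for k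
  proof (induction k)
    case 0
    then show ?case using bound[of 1] by (simp add: W0 P0)
  next
    case (Suc k)
    show ?case
    proof
      fix x :: real assume x: "x \<in> {0..1}"
      have "integral {0..x} (\<lambda>t. r t * P k t) \<le> integral {0..x} (\<lambda>t. r t * P (Suc k) t)"
        "integral {0..x} (\<lambda>t. q t * W k t) \<le> integral {0..x} (\<lambda>t. q t * W (Suc k) t)"
        using Suc x r(2) q(2) by (auto intro!: integral_le rPx qWx mult_left_mono)
      then show "W (Suc k) x \<le> W (Suc (Suc k)) x \<and> P (Suc k) x \<le> P (Suc (Suc k)) x"
        by (subst (1 2) WS, subst (1 2) PS) simp
    qed
  qed
  define w where "w x = lim (\<lambda>k. W k x)" for x
  define p where "p x = lim (\<lambda>k. P k x)" for x
  have Wlim: "(\<lambda>k. W k x) \<longlonglongrightarrow> w x" and Plim: "(\<lambda>k. P k x) \<longlonglongrightarrow> p x" if "x \<in> {0..1}" for x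
  proof -
    have "incseq (\<lambda>k. W k x)" "incseq (\<lambda>k. P k x)" using mono that by (auto intro!: incseq_SucI)
    moreover have "W k x \<le> E x" "P k x \<le> E x" for k using bound that by auto
    ultimately have "convergent (\<lambda>k. W k x)" "convergent (\<lambda>k. P k x)"
      by (metis incseq_convergent convergentI)+
    then show "(\<lambda>k. W k x) \<longlonglongrightarrow> w x" "(\<lambda>k. P k x) \<longlonglongrightarrow> p x"
      unfolding w_def p_def convergent_LIMSEQ_iff .
  qed
  have w_eq: "((\<lambda>t. r t * p t) has_integral (w x - a)) {0..x}" if x: "x \<in> {0..1}" for x
  proof (rule has_integral_monotone_convergence_increasing)
    show "((\<lambda>t. r t * P k t) has_integral (W (Suc k) x - a)) {0..x}" for k
      using rPx[OF x] by (simp add: WS has_integral_iff)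
    show "r t * P k t \<le> r t * P (Suc k) t" if "t \<in> {0..x}" for k t
      using that x mono r(2) by (auto intro: mult_left_mono)
    show "(\<lambda>k. r t * P k t) \<longlonglongrightarrow> r t * p t" if "t \<in> {0..x}" for t
      using that x by (intro tendsto_intros Plim) auto
    show "(\<lambda>k. W (Suc k) x - a) \<longlonglongrightarrow> w x - a"
      using LIMSEQ_Suc[OF Wlim[OF x]] by (intro tendsto_intros)
  qed
  have p_eq: "((\<lambda>t. q t * w t) has_integral (p x - b)) {0..x}" if x: "x \<in> {0..1}" for x
  proof (rule has_integral_monotone_convergence_increasing)
    show "((\<lambda>t. q t * W k t) has_integral (P (Suc k) x - b)) {0..x}" for k
      using qWx[OF x] by (simp add: PS has_integral_iff)
    show "q t * W k t \<le> q t * W (Suc k) t" if "t \<in> {0..x}" for k t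
      using that x mono q(2) by (auto intro: mult_left_mono)
    show "(\<lambda>k. q t * W k t) \<longlonglongrightarrow> q t * w t" if "t \<in> {0..x}" for t
      using that x by (intro tendsto_intros Wlim) auto
    show "(\<lambda>k. P (Suc k) x - b) \<longlonglongrightarrow> p x - b"
      using LIMSEQ_Suc[OF Plim[OF x]] by (intro tendsto_intros)
  qed
  \<comment> \<open>The derivative at an interior point needs the integral equation in a neighbourhood, so the solution is defined by its right-hand side; it agrees with the limit on \<open>[0, 1]\<close>.\<close>
  define w' where "w' x = a + integral {0..x} (\<lambda>t. r t * p t)" for x
  define p' where "p' x = b + integral {0..x} (\<lambda>t. q t * w t)" for x
  have eq: "w' x = w x" "p' x = p x" if "x \<in> {0..1}" for x
    using integral_unique[OF w_eq[OF that]] integral_unique[OF p_eq[OF that]] by (auto simp: w'_def p'_def)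
  have lim_nonneg: "0 \<le> w x" "0 \<le> p x" if "x \<in> {0..1}" for x
    using bound that
    by (auto intro!: LIMSEQ_le_const[OF Wlim[OF that]] LIMSEQ_le_const[OF Plim[OF that]])
  have rp: "(\<lambda>t. r t * p t) absolutely_integrable_on {0..1}"
    using w_eq[of 1] lim_nonneg r(2) by (intro nonnegative_absolutely_integrable_1) auto
  have qw: "(\<lambda>t. q t * w t) absolutely_integrable_on {0..1}"
    using p_eq[of 1] lim_nonneg q(2) by (intro nonnegative_absolutely_integrable_1) auto
  have "flux_system r q w' p'"
    unfolding flux_system_def
  proof (intro conjI)
    show "absolutely_continuous_on 0 1 w'"
      using absolutely_continuous_on_indefinite_integral[OF rp]
      by (rule absolutely_continuous_on_dominated[rotated, where B=1]) (auto simp: w'_def intro: absolutely_continuous_on_indefinite_integral[OF rp])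
    show "absolutely_continuous_on 0 1 p'"
      using absolutely_continuous_on_indefinite_integral[OF qw]
      by (rule absolutely_continuous_on_dominated[rotated, where B=1]) (auto simp: p'_def intro: absolutely_continuous_on_indefinite_integral[OF qw])
    have 1: "AE x in lebesgue_on {0..1}. ((\<lambda>x. integral {0..x} (\<lambda>t. r t * p t)) has_vector_derivative r x * p x) (at x)"
      and 2: "AE x in lebesgue_on {0..1}. ((\<lambda>x. integral {0..x} (\<lambda>t. q t * w t)) has_vector_derivative q x * w x) (at x)"
      using rp qw by (auto intro!: has_vector_derivative_indefinite_integral_AE simp: absolutely_integrable_on_def)
    have 3: "AE x in lebesgue_on {0..1::real}. x \<in> {0..1}" by (auto intro: AE_I2)
    show "AE x in lebesgue_on {0..1}. (w' has_vector_derivative r x *\<^sub>R p' x) (at x) \<and>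
        (p' has_vector_derivative q x *\<^sub>R w' x) (at x)"
      using 1 2 3
    proof eventually_elim
      case (elim x)
      have "(w' has_vector_derivative 0 + r x * p x) (at x)" "(p' has_vector_derivative 0 + q x * w x) (at x)"
        unfolding w'_def[abs_def] p'_def[abs_def]
        by (rule has_vector_derivative_add[OF has_vector_derivative_const], rule elim)+
      then show ?case using eq[OF elim(3)] by simp
    qed
  qed
  then show thesis by (rule that) (auto simp: w'_def p'_def)
qed

text \<open>Shooting. If the solution \<open>s\<close> with \<open>s(0) = 0\<close> and flux \<open>1\<close> at \<open>0\<close> also vanished at \<open>1\<close>, then its
  flux would vanish by uniqueness. So a multiple of \<open>s\<close> corrects the value at \<open>1\<close> of the solution
  started from \<open>\<alpha>\<close> with flux \<open>0\<close>.\<close>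

lemma flux_system_boundary_value:
  fixes r q :: "real \<Rightarrow> real" and \<alpha> \<beta> :: "'a::euclidean_space"
  assumes r: "r integrable_on {0..1}" "\<And>x. 0 \<le> r x"
    and q: "q integrable_on {0..1}" "\<And>x. 0 \<le> q x"
    and r_pos: "AE x in lebesgue_on {0..1}. 0 < r x"
  obtains w p where "flux_system r q w p" "w 0 = \<alpha>" "w 1 = \<beta>"
proof -
  obtain c pc where c: "flux_system r q c pc" "c 0 = (1::real)" "pc 0 = 0"
    using flux_system_initial_value[OF r q, of 1 0] by auto
  obtain s ps where s: "flux_system r q s ps" "s 0 = (0::real)" "ps 0 = 1"
    using flux_system_initial_value[OF r q, of 0 1] by auto
  have "s 1 \<noteq> 0"
    using flux_system_zero_boundary(2)[OF r(2) q(2) s(1,2) _ r_pos, of 0] s(3) by auto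
  define \<gamma> where "\<gamma> = (\<beta> - c 1 *\<^sub>R \<alpha>) /\<^sub>R s 1"
  show thesis
  proof (rule that)
    show "flux_system r q (\<lambda>x. c x *\<^sub>R \<alpha> + s x *\<^sub>R \<gamma>) (\<lambda>x. pc x *\<^sub>R \<alpha> + ps x *\<^sub>R \<gamma>)"
      by (intro flux_system_add flux_system_bounded_linear[OF bounded_linear_scaleR_left] c s)
    show "c 0 *\<^sub>R \<alpha> + s 0 *\<^sub>R \<gamma> = \<alpha>" "c 1 *\<^sub>R \<alpha> + s 1 *\<^sub>R \<gamma> = \<beta>"
      using c s \<open>s 1 \<noteq> 0\<close> by (auto simp: \<gamma>_def)
  qed
qed

section \<open>Measurable families of orthonormal expansions\<close>

lemma orthonormal_integrable_product:
  assumes "orthonormal_basis_L2 V Y"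
  shows "integrable V (\<lambda>k. Y i k * cnj (Y j k))"
proof -
  have Y: "Y m \<in> borel_measurable V" "integrable V (\<lambda>k. (norm (Y m k))\<^sup>2)" for m
    using assms by (auto simp: orthonormal_basis_L2_def L2_space_def)
  show ?thesis
  proof (rule Bochner_Integration.integrable_bound)
    show "integrable V (\<lambda>k. (norm (Y i k))\<^sup>2 + (norm (Y j k))\<^sup>2)"
      using Y by (intro Bochner_Integration.integrable_add)
    have "(\<lambda>k. cnj (Y j k)) \<in> borel_measurable V"
      using borel_measurable_continuous_on[OF continuous_on_cnj[OF continuous_on_id] Y(1)] by simp
    then show "(\<lambda>k. Y i k * cnj (Y j k)) \<in> borel_measurable V"
      using Y(1) by (intro borel_measurable_times)
    have "norm (Y i k * cnj (Y j k)) \<le> norm ((norm (Y i k))\<^sup>2 + (norm (Y j k))\<^sup>2)" for k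
    proof -
      have "2 * (norm (Y i k) * norm (Y j k)) \<le> (norm (Y i k))\<^sup>2 + (norm (Y j k))\<^sup>2"
        using sum_squares_bound[of "norm (Y i k)" "norm (Y j k)"] by simp
      moreover have "0 \<le> norm (Y i k) * norm (Y j k)" by (rule mult_nonneg_nonneg) auto
      ultimately have "norm (Y i k) * norm (Y j k) \<le> (norm (Y i k))\<^sup>2 + (norm (Y j k))\<^sup>2"
        by linarith
      then show ?thesis by (simp add: norm_mult)
    qed
    then show "AE k in V. norm (Y i k * cnj (Y j k)) \<le> norm ((norm (Y i k))\<^sup>2 + (norm (Y j k))\<^sup>2)"
      by simp
  qed
qed

lemma nn_integral_orthonormal_sum:
  assumes Y: "orthonormal_basis_L2 V Y" and F: "finite F"
  shows "(\<integral>\<^sup>+k. ennreal ((norm (\<Sum>m\<in>F. a m * Y m k))\<^sup>2) \<partial>V) = ennreal (\<Sum>m\<in>F. (norm (a m))\<^sup>2)"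
proof -
  define g where "g k = (\<Sum>i\<in>F. \<Sum>j\<in>F. (a i * cnj (a j)) * (Y i k * cnj (Y j k)))" for k
  have inner: "(\<integral>k. Y i k * cnj (Y j k) \<partial>V) = (if i = j then 1 else 0)" for i j
    using Y by (auto simp: orthonormal_basis_L2_def L2_inner_def)
  have gi: "integrable V g"
    unfolding g_def
    by (intro Bochner_Integration.integrable_sum integrable_mult_right orthonormal_integrable_product[OF Y])
  have "(\<integral>k. g k \<partial>V) = (\<Sum>i\<in>F. \<Sum>j\<in>F. (a i * cnj (a j)) * (if i = j then 1 else 0))"
    unfolding g_def
    by (subst Bochner_Integration.integral_sum Bochner_Integration.integral_sum integral_mult_right_zero inner
      | intro Bochner_Integration.integrable_sum integrable_mult_right orthonormal_integrable_product[OF Y] sum.cong refl)+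
  also have "\<dots> = complex_of_real (\<Sum>m\<in>F. (norm (a m))\<^sup>2)"
    using F by (simp add: if_distrib sum.delta complex_norm_square[symmetric] cong: if_cong)
  finally have int: "(\<integral>k. g k \<partial>V) = complex_of_real (\<Sum>m\<in>F. (norm (a m))\<^sup>2)" .
  have eq: "Re (g k) = (norm (\<Sum>m\<in>F. a m * Y m k))\<^sup>2" for k
  proof -
    have "g k = (\<Sum>m\<in>F. a m * Y m k) * cnj (\<Sum>m\<in>F. a m * Y m k)"
      by (simp add: g_def sum_product cnj_sum mult_ac)
    then show ?thesis by (simp only: complex_norm_square[symmetric] Re_complex_of_real)
  qed
  have "(\<integral>\<^sup>+k. ennreal (Re (g k)) \<partial>V) = ennreal (\<integral>k. Re (g k) \<partial>V)"
  proof (rule nn_integral_eq_integral)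
    show "integrable V (\<lambda>k. Re (g k))" using gi by (rule integrable_Re)
  qed (simp add: eq)
  also have "(\<integral>k. Re (g k) \<partial>V) = (\<Sum>m\<in>F. (norm (a m))\<^sup>2)"
    using gi int by simp
  finally show ?thesis by (simp add: eq)
qed

lemma L2_expansion_unique:
  assumes Y: "\<And>m. Y m \<in> borel_measurable V"
    and f: "L2_expansion V Y a f" and g: "L2_expansion V Y a g"
  shows "AE k in V. f k = g k"
proof -
  define S where "S N k = (\<Sum>m<N. a m * Y m k)" for N k
  have mf: "f \<in> borel_measurable V" and mg: "g \<in> borel_measurable V" and mS: "S N \<in> borel_measurable V" for N
    using f g Y by (auto simp: L2_expansion_def L2_space_def S_def[abs_def])
  have "(\<integral>\<^sup>+k. ennreal ((norm (f k - g k))\<^sup>2) \<partial>V)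
      \<le> 2 * (\<integral>\<^sup>+k. ennreal ((norm (f k - S N k))\<^sup>2) \<partial>V) + 2 * (\<integral>\<^sup>+k. ennreal ((norm (g k - S N k))\<^sup>2) \<partial>V)" for N
  proof -
    have "ennreal ((norm (f k - g k))\<^sup>2)
        \<le> 2 * ennreal ((norm (f k - S N k))\<^sup>2) + 2 * ennreal ((norm (g k - S N k))\<^sup>2)" for k
    proof -
      have "norm (f k - g k) \<le> norm (f k - S N k) + norm (g k - S N k)"
        using norm_triangle_ineq4[of "f k - S N k" "g k - S N k"] by simp
      then have "(norm (f k - g k))\<^sup>2 \<le> (norm (f k - S N k) + norm (g k - S N k))\<^sup>2"
        by (rule power_mono) simp
      also have "\<dots> \<le> 2 * (norm (f k - S N k))\<^sup>2 + 2 * (norm (g k - S N k))\<^sup>2"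
        using sum_squares_bound[of "norm (f k - S N k)" "norm (g k - S N k)"]
        by (simp add: power2_sum)
      finally have "ennreal ((norm (f k - g k))\<^sup>2)
          \<le> ennreal (2 * (norm (f k - S N k))\<^sup>2 + 2 * (norm (g k - S N k))\<^sup>2)"
        by (rule ennreal_leI)
      then show ?thesis by (simp add: ennreal_plus ennreal_mult)
    qed
    then have "(\<integral>\<^sup>+k. ennreal ((norm (f k - g k))\<^sup>2) \<partial>V)
        \<le> (\<integral>\<^sup>+k. 2 * ennreal ((norm (f k - S N k))\<^sup>2) + 2 * ennreal ((norm (g k - S N k))\<^sup>2) \<partial>V)"
      by (rule nn_integral_mono)
    also have "\<dots> = 2 * (\<integral>\<^sup>+k. ennreal ((norm (f k - S N k))\<^sup>2) \<partial>V) + 2 * (\<integral>\<^sup>+k. ennreal ((norm (g k - S N k))\<^sup>2) \<partial>V)"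
      using mf mg mS[of N] by (simp add: nn_integral_add nn_integral_cmult)
    finally show ?thesis .
  qed
  moreover have "(\<lambda>N. 2 * (\<integral>\<^sup>+k. ennreal ((norm (f k - S N k))\<^sup>2) \<partial>V)
      + 2 * (\<integral>\<^sup>+k. ennreal ((norm (g k - S N k))\<^sup>2) \<partial>V)) \<longlonglongrightarrow> 2 * 0 + 2 * 0"
    using f g unfolding L2_expansion_def S_def
    by (intro tendsto_add ennreal_tendsto_cmult) auto
  ultimately have "(\<integral>\<^sup>+k. ennreal ((norm (f k - g k))\<^sup>2) \<partial>V) \<le> 2 * 0 + 2 * 0"
    by (intro LIMSEQ_le_const) auto
  then have "(\<integral>\<^sup>+k. ennreal ((norm (f k - g k))\<^sup>2) \<partial>V) = 0" by simp
  then have "AE k in V. ennreal ((norm (f k - g k))\<^sup>2) = 0"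
    using mf mg by (subst (asm) nn_integral_0_iff_AE) auto
  then show ?thesis by eventually_elim (simp add: ennreal_eq_0_iff)
qed

lemma summable_tail_tendsto_0:
  fixes a :: "nat \<Rightarrow> real"
  assumes "summable a"
  shows "(\<lambda>n. \<Sum>m. a (m + n)) \<longlonglongrightarrow> 0"
proof -
  have "(\<lambda>n. suminf a - sum a {..<n}) \<longlonglongrightarrow> suminf a - suminf a"
    by (intro tendsto_diff tendsto_const summable_LIMSEQ assms)
  then show ?thesis by (simp add: suminf_minus_initial_segment[OF assms])
qed

text \<open>The square integrals decay like \<open>4\<^sup>-\<^sup>j\<close>, so \<open>\<Sum>\<^sub>j 2\<^sup>j |d\<^sub>j|\<^sup>2\<close> still has a finite integral. Where
  that sum is finite, \<open>|d\<^sub>j|\<close> is at most a constant times \<open>2\<^sup>-\<^sup>j\<^sup>/\<^sup>2\<close>.\<close>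

lemma AE_summable_of_geometric_L2_norms:
  assumes d: "\<And>j. d j \<in> borel_measurable V"
    and bd: "\<And>j. (\<integral>\<^sup>+k. ennreal ((norm (d j k))\<^sup>2) \<partial>V) \<le> ennreal ((1 / 4) ^ j)"
  shows "AE k in V. summable (\<lambda>j. d j k :: complex)"
proof -
  have "(\<integral>\<^sup>+k. (\<Sum>j. ennreal (2 ^ j * (norm (d j k))\<^sup>2)) \<partial>V)
      = (\<Sum>j. \<integral>\<^sup>+k. ennreal (2 ^ j * (norm (d j k))\<^sup>2) \<partial>V)"
    using d by (intro nn_integral_suminf) measurable
  also have "\<dots> \<le> (\<Sum>j. ennreal ((1 / 2) ^ j))"
  proof (rule suminf_le)
    fix j
    have "(\<integral>\<^sup>+k. ennreal (2 ^ j * (norm (d j k))\<^sup>2) \<partial>V) = ennreal (2 ^ j) * (\<integral>\<^sup>+k. ennreal ((norm (d j k))\<^sup>2) \<partial>V)"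
      using d[of j] by (simp add: ennreal_mult nn_integral_cmult)
    also have "\<dots> \<le> ennreal (2 ^ j) * ennreal ((1 / 4) ^ j)" by (intro mult_left_mono bd) simp
    also have "\<dots> = ennreal ((2 * (1 / 4)) ^ j)"
      by (subst ennreal_mult[symmetric]) (simp_all only: power_mult_distrib, auto)
    finally show "(\<integral>\<^sup>+k. ennreal (2 ^ j * (norm (d j k))\<^sup>2) \<partial>V) \<le> ennreal ((1 / 2) ^ j)" by simp
  qed auto
  also have "\<dots> = ennreal (\<Sum>j. (1 / 2) ^ j)"
    by (intro suminf_ennreal2) auto
  also have "\<dots> < \<infinity>" by simp
  finally have "AE k in V. (\<Sum>j. ennreal (2 ^ j * (norm (d j k))\<^sup>2)) \<noteq> \<infinity>"
    using d by (intro nn_integral_PInf_AE) auto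
  then show ?thesis
  proof eventually_elim
    case (elim k)
    then have "summable (\<lambda>j. 2 ^ j * (norm (d j k))\<^sup>2)"
      by (intro summable_suminf_not_top) (auto simp: top_ennreal_def[symmetric])
    then have "(\<lambda>j. 2 ^ j * (norm (d j k))\<^sup>2) \<longlonglongrightarrow> 0" by (rule summable_LIMSEQ_zero)
    then obtain B where B: "B > 0" "\<And>j. norm (2 ^ j * (norm (d j k))\<^sup>2) \<le> B"
      using BseqE[OF convergent_imp_Bseq[OF convergentI]] by blast
    show ?case
    proof (rule summable_comparison_test')
      show "summable (\<lambda>j. sqrt B * sqrt (1 / 2) ^ j)"
        by (intro summable_mult summable_geometric) (simp add: real_sqrt_lt_1_iff)
      fix j
      have "(norm (d j k))\<^sup>2 \<le> B * (1 / 2) ^ j"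
        using B(2)[of j] by (simp add: field_simps power_divide)
      then have "norm (d j k) \<le> sqrt (B * (1 / 2) ^ j)" by (rule real_le_rsqrt)
      then show "norm (d j k) \<le> sqrt B * sqrt (1 / 2) ^ j"
        by (simp add: real_sqrt_mult real_sqrt_power)
    qed
  qed
qed

text \<open>The tails of the majorant \<open>a\<close> bound the \<open>L\<^sup>2\<close> distance between partial sums for all \<open>x\<close> at once. So
  one sequence of indices \<open>N j\<close> makes the partial sums converge almost everywhere on \<open>V\<close> for every
  \<open>x\<close>. Being a limit along a fixed sequence, \<open>u\<close> is jointly measurable, and Fatou's lemma identifies
  it with the \<open>L\<^sup>2\<close> sum.\<close>

lemma L2_expansion_exists_measurable:
  fixes c :: "nat \<Rightarrow> 'x \<Rightarrow> complex"
  assumes Y: "orthonormal_basis_L2 V Y"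
    and c: "\<And>m. c m \<in> borel_measurable X"
    and a: "summable a" "\<And>m x. x \<in> space X \<Longrightarrow> (norm (c m x))\<^sup>2 \<le> a m" "\<And>m. 0 \<le> a m"
  obtains u where "(\<lambda>(x, k). u x k) \<in> borel_measurable (X \<Otimes>\<^sub>M V)"
    "\<And>x. x \<in> space X \<Longrightarrow> L2_expansion V Y (\<lambda>m. c m x) (u x)"
proof -
  have mY: "Y m \<in> borel_measurable V" for m
    using Y by (auto simp: orthonormal_basis_L2_def L2_space_def)
  define T where "T n = (\<Sum>m. a (m + n))" for n
  have T_lim: "T \<longlonglongrightarrow> 0" using summable_tail_tendsto_0[OF a(1)] by (simp add: T_def[abs_def])
  have block: "sum a F \<le> T n" if "F \<subseteq> {n..}" "finite F" for F n
  proof -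
    have "sum a F = (\<Sum>m\<in>(\<lambda>i. i - n) ` F. a (m + n))"
      using that(1) by (intro sum.reindex_bij_witness[of _ "\<lambda>i. i + n" "\<lambda>i. i - n"]) auto
    also have "\<dots> \<le> T n" unfolding T_def
      using a that by (intro sum_le_suminf) (auto simp: summable_iff_shift)
    finally show ?thesis .
  qed
  have T_anti: "T n \<le> T m" if "m \<le> n" for m n
  proof -
    have "T i = suminf a - sum a {..<i}" for i
      by (simp add: T_def suminf_minus_initial_segment[OF a(1)])
    moreover have "sum a {..<m} \<le> sum a {..<n}" using that a(3) by (intro sum_mono2) auto
    ultimately show ?thesis by simp
  qed
  have "\<exists>n. T n \<le> (1 / 4) ^ j" for j :: nat
  proof -
    have "\<forall>\<^sub>F n in sequentially. T n < (1 / 4) ^ j" by (rule order_tendstoD(2)[OF T_lim]) simp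
    then obtain n where "T n < (1 / 4) ^ j" using eventually_happens'[OF sequentially_bot] by blast
    then show ?thesis by (intro exI[of _ n]) simp
  qed
  then obtain N0 where N0: "\<And>j. T (N0 j) \<le> (1 / 4) ^ j" by metis
  \<comment> \<open>The summation makes \<open>N\<close> nondecreasing, and the summand \<open>j\<close> makes it unbounded.\<close>
  define N where "N j = j + (\<Sum>i\<le>j. N0 i)" for j
  have N_T: "T (N j) \<le> (1 / 4) ^ j" for j
  proof -
    have "N0 j \<le> (\<Sum>i\<le>j. N0 i)" by (rule member_le_sum) auto
    then show ?thesis using T_anti[of "N0 j" "N j"] N0[of j] by (simp add: N_def)
  qed
  have N_mono: "N j \<le> N (Suc j)" and N_ge: "j \<le> N j" for j by (auto simp: N_def)
  define S where "S n x k = (\<Sum>m<n. c m x * Y m k)" for n x k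
  have S_diff: "(\<integral>\<^sup>+k. ennreal ((norm (S n x k - S m x k))\<^sup>2) \<partial>V) \<le> ennreal (T m)"
    if "m \<le> n" "x \<in> space X" for m n x
  proof -
    have "S n x k - S m x k = (\<Sum>i\<in>{m..<n}. c i x * Y i k)" for k
      using sum_diff_nat_ivl[of 0 m n "\<lambda>i. c i x * Y i k"] that
      by (simp add: S_def atLeast0LessThan)
    then have "(\<integral>\<^sup>+k. ennreal ((norm (S n x k - S m x k))\<^sup>2) \<partial>V) = ennreal (\<Sum>i\<in>{m..<n}. (norm (c i x))\<^sup>2)"
      using nn_integral_orthonormal_sum[OF Y, of "{m..<n}" "\<lambda>i. c i x"] by simp
    also have "(\<Sum>i\<in>{m..<n}. (norm (c i x))\<^sup>2) \<le> sum a {m..<n}" by (intro sum_mono a that)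
    also have "sum a {m..<n} \<le> T m" by (intro block) auto
    finally show ?thesis by (simp add: ennreal_leI)
  qed
  define u where "u x k = lim (\<lambda>j. S (N j) x k)" for x k
  have mS2: "(\<lambda>(x, k). S n x k) \<in> borel_measurable (X \<Otimes>\<^sub>M V)" for n
    unfolding S_def using c mY by measurable
  have mu: "(\<lambda>(x, k). u x k) \<in> borel_measurable (X \<Otimes>\<^sub>M V)"
  proof -
    have "(\<lambda>p. lim (\<lambda>j. (\<lambda>(x, k). S (N j) x k) p)) \<in> borel_measurable (X \<Otimes>\<^sub>M V)"
      by (intro borel_measurable_lim_metric mS2)
    then show ?thesis by (simp add: u_def case_prod_unfold)
  qed
  show thesis
  proof (rule that[OF mu])
    fix x assume x: "x \<in> space X"
    have mux: "u x \<in> borel_measurable V"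
      using measurable_Pair2[OF mu x] by simp
    have mS: "S n x \<in> borel_measurable V" for n
      unfolding S_def using mY by measurable
    have "AE k in V. summable (\<lambda>j. S (N (Suc j)) x k - S (N j) x k)"
    proof (rule AE_summable_of_geometric_L2_norms)
      show "(\<integral>\<^sup>+k. ennreal ((norm (S (N (Suc j)) x k - S (N j) x k))\<^sup>2) \<partial>V) \<le> ennreal ((1 / 4) ^ j)" for j
        using S_diff[OF N_mono x, of j] N_T[of j] ennreal_leI order_trans by blast
    qed (use mS in measurable)
    then have S_lim: "AE k in V. (\<lambda>j. S (N j) x k) \<longlonglongrightarrow> u x k"
    proof eventually_elim
      case (elim k)
      have "(\<Sum>i<j. S (N (Suc i)) x k - S (N i) x k) = S (N j) x k - S (N 0) x k" for j
        by (rule sum_lessThan_telescope)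
      then have "(\<lambda>j. S (N 0) x k + (S (N j) x k - S (N 0) x k)) \<longlonglongrightarrow>
          S (N 0) x k + (\<Sum>j. S (N (Suc j)) x k - S (N j) x k)"
        using summable_LIMSEQ[OF elim] by (intro tendsto_add tendsto_const) simp
      then have "convergent (\<lambda>j. S (N j) x k)" by (auto simp: convergent_def)
      then show ?case unfolding u_def convergent_LIMSEQ_iff .
    qed
    have fatou: "(\<integral>\<^sup>+k. ennreal ((norm (u x k - S n x k))\<^sup>2) \<partial>V) \<le> ennreal (T n)" for n
    proof -
      have "(\<integral>\<^sup>+k. ennreal ((norm (u x k - S n x k))\<^sup>2) \<partial>V)
          = (\<integral>\<^sup>+k. liminf (\<lambda>j. ennreal ((norm (S (N j) x k - S n x k))\<^sup>2)) \<partial>V)"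
      proof (rule nn_integral_cong_AE)
        show "AE k in V. ennreal ((norm (u x k - S n x k))\<^sup>2)
            = liminf (\<lambda>j. ennreal ((norm (S (N j) x k - S n x k))\<^sup>2))"
          using S_lim
        proof eventually_elim
          case (elim k)
          have "(\<lambda>j. ennreal ((norm (S (N j) x k - S n x k))\<^sup>2)) \<longlonglongrightarrow> ennreal ((norm (u x k - S n x k))\<^sup>2)"
            by (intro tendsto_ennrealI tendsto_power tendsto_norm tendsto_diff elim tendsto_const)
          then show ?case by (intro lim_imp_Liminf[symmetric]) auto
        qed
      qed
      also have "\<dots> \<le> liminf (\<lambda>j. \<integral>\<^sup>+k. ennreal ((norm (S (N j) x k - S n x k))\<^sup>2) \<partial>V)"
        using mS by (intro nn_integral_liminf) measurable
      also have "\<dots> \<le> limsup (\<lambda>j. \<integral>\<^sup>+k. ennreal ((norm (S (N j) x k - S n x k))\<^sup>2) \<partial>V)"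
        by (intro Liminf_le_Limsup) auto
      also have "\<dots> \<le> ennreal (T n)"
      proof (rule Limsup_bounded)
        show "\<forall>\<^sub>F j in sequentially. (\<integral>\<^sup>+k. ennreal ((norm (S (N j) x k - S n x k))\<^sup>2) \<partial>V) \<le> ennreal (T n)"
          by (intro eventually_sequentiallyI[of n] S_diff x) (use N_ge order_trans in blast)
      qed
      finally show ?thesis .
    qed
    show "L2_expansion V Y (\<lambda>m. c m x) (u x)"
      unfolding L2_expansion_def
    proof
      have "(\<integral>\<^sup>+k. ennreal ((norm (u x k))\<^sup>2) \<partial>V) < \<infinity>"
        using fatou[of 0] by (simp add: S_def order_le_less_trans)
      then show "u x \<in> L2_space V"
        using mux by (auto simp: L2_space_def intro!: integrableI_nonneg)
      have T0: "(\<lambda>n. ennreal (T n)) \<longlonglongrightarrow> 0" using tendsto_ennrealI[OF T_lim] by simp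
      show "(\<lambda>n. \<integral>\<^sup>+k. ennreal ((norm (u x k - (\<Sum>m<n. c m x * Y m k)))\<^sup>2) \<partial>V) \<longlonglongrightarrow> 0"
      proof (rule tendsto_sandwich[OF _ _ tendsto_const T0])
        show "\<forall>\<^sub>F n in sequentially. (\<integral>\<^sup>+k. ennreal ((norm (u x k - (\<Sum>m<n. c m x * Y m k)))\<^sup>2) \<partial>V) \<le> ennreal (T n)"
          using fatou unfolding S_def by (intro always_eventually allI)
      qed simp
    qed
  qed
qed

section \<open>Radial modes for a weight\<close>

lemma abs_sqrt: "\<bar>sqrt x\<bar> = sqrt \<bar>x\<bar>"
  by (cases "x \<ge> 0") (auto simp: real_sqrt_minus[symmetric] abs_if)

lemma sum_squared_le: "(x + y)\<^sup>2 \<le> 2 * (x\<^sup>2 + y\<^sup>2)" for x y :: real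
  using sum_squares_bound[of x y] by (simp add: power2_sum)

text \<open>Only the values of \<open>h\<close> almost everywhere matter, but on a null set \<open>h\<close> may be negative, and then so
  is \<open>sqrt (h x)\<close>. The coefficients of the system are therefore formed from \<open>\<bar>h x\<bar>\<close>, which makes them
  nonnegative at every point.\<close>

locale integrable_weight =
  fixes h :: "real \<Rightarrow> real"
  assumes h_pos: "AE x in lebesgue_on {0..1}. 0 < h x"
    and integrable_sqrt: "integrable (lebesgue_on {0..1}) (\<lambda>x. sqrt (h x))"
    and integrable_inverse_sqrt: "integrable (lebesgue_on {0..1}) (\<lambda>x. 1 / sqrt (h x))"
begin

text \<open>In the analogy with a wire of conductivity \<open>\<surd>h\<close>, in which a potential \<open>w\<close> drives the current
  \<open>p = \<surd>h w'\<close>, the total resistance is \<open>\<integral> 1/\<surd>h\<close>.\<close>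

definition resistance :: real where
  "resistance = (LINT x|lebesgue_on {0..1}. 1 / sqrt \<bar>h x\<bar>)"

definition mass :: real where
  "mass = (LINT x|lebesgue_on {0..1}. sqrt \<bar>h x\<bar>)"

lemma integrable_sqrt_abs: "integrable (lebesgue_on {0..1}) (\<lambda>x. sqrt \<bar>h x\<bar>)"
  using integrable_abs[OF integrable_sqrt] by (simp add: abs_sqrt)

lemma integrable_inverse_sqrt_abs: "integrable (lebesgue_on {0..1}) (\<lambda>x. 1 / sqrt \<bar>h x\<bar>)"
  using integrable_abs[OF integrable_inverse_sqrt] by (simp add: abs_divide abs_sqrt)

lemma has_integral_mass: "((\<lambda>x. sqrt \<bar>h x\<bar>) has_integral mass) {0..1}"
  unfolding mass_def by (rule has_integral_integral_lebesgue_on[OF integrable_sqrt_abs]) simp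

lemma has_integral_resistance: "((\<lambda>x. 1 / sqrt \<bar>h x\<bar>) has_integral resistance) {0..1}"
  unfolding resistance_def by (rule has_integral_integral_lebesgue_on[OF integrable_inverse_sqrt_abs]) simp

lemma mass_nonneg: "0 \<le> mass"
  unfolding mass_def by (rule Bochner_Integration.integral_nonneg) simp

lemma inverse_sqrt_abs_pos: "AE x in lebesgue_on {0..1}. 0 < 1 / sqrt \<bar>h x\<bar>"
  using h_pos by eventually_elim simp

lemma resistance_pos: "0 < resistance"
proof -
  have "0 \<le> resistance"
    unfolding resistance_def by (rule Bochner_Integration.integral_nonneg) simp
  moreover have "resistance \<noteq> 0"
  proof
    assume "resistance = 0"
    then have "AE x in lebesgue_on {0..1}. 1 / sqrt \<bar>h x\<bar> = 0"
      unfolding resistance_def by (subst (asm) integral_nonneg_eq_0_iff_AE[OF integrable_inverse_sqrt_abs]) auto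
    then have "AE x in lebesgue_on {0..1::real}. False"
      using inverse_sqrt_abs_pos by eventually_elim simp
    then have "\<exists>N. negligible N \<and> {0..1::real} \<subseteq> N"
      by (subst (asm) AE_lebesgue_on_iff_negligible) auto
    then have "negligible {0<..<1::real}" by (meson negligible_subset greaterThanLessThan_subseteq_atLeastAtMost_iff order_refl)
    then show False using open_not_negligible[of "{0<..<1::real}"] by auto
  qed
  ultimately show ?thesis by simp
qed

lemma mode_solution_iff_flux_system:
  "mode_solution h mu b w p \<longleftrightarrow>
     flux_system (\<lambda>x. 1 / sqrt \<bar>h x\<bar>) (\<lambda>x. mu * sqrt \<bar>h x\<bar>) w p \<and> w 0 = fst b \<and> w 1 = snd b"
proof -
  have 1: "(\<exists>d. (w has_vector_derivative d) (at x) \<and> p x = sqrt (h x) *\<^sub>R d)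
      \<longleftrightarrow> (w has_vector_derivative (1 / sqrt \<bar>h x\<bar>) *\<^sub>R p x) (at x)" if "0 < h x" for x
    using that by (auto intro!: exI[of _ "(1 / sqrt (h x)) *\<^sub>R p x"])
  have 2: "(\<exists>d. (p has_vector_derivative d) (at x) \<and> - ((1 / sqrt (h x)) *\<^sub>R d) = - (mu *\<^sub>R w x))
      \<longleftrightarrow> (p has_vector_derivative (mu * sqrt \<bar>h x\<bar>) *\<^sub>R w x) (at x)" (is "(\<exists>d. ?D d \<and> ?E d) \<longleftrightarrow> _")
    if "0 < h x" for x
  proof -
    have "?E d \<longleftrightarrow> d = (mu * sqrt \<bar>h x\<bar>) *\<^sub>R w x" for d
    proof -
      have "?E d \<longleftrightarrow> (1 / sqrt (h x)) *\<^sub>R d = mu *\<^sub>R w x" by simp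
      also have "\<dots> \<longleftrightarrow> sqrt (h x) *\<^sub>R (1 / sqrt (h x)) *\<^sub>R d = sqrt (h x) *\<^sub>R mu *\<^sub>R w x"
        using that by (subst scaleR_cancel_left) simp
      also have "\<dots> \<longleftrightarrow> d = (mu * sqrt \<bar>h x\<bar>) *\<^sub>R w x" using that by (simp add: mult.commute)
      finally show ?thesis .
    qed
    then show ?thesis by simp
  qed
  have "(AE x in lebesgue_on {0..1}. \<exists>d. (w has_vector_derivative d) (at x) \<and> p x = sqrt (h x) *\<^sub>R d)
      \<longleftrightarrow> (AE x in lebesgue_on {0..1}. (w has_vector_derivative (1 / sqrt \<bar>h x\<bar>) *\<^sub>R p x) (at x))"
    by (intro eventually_subst eventually_mono[OF h_pos] 1)
  moreover have "(AE x in lebesgue_on {0..1}.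
      \<exists>d. (p has_vector_derivative d) (at x) \<and> - ((1 / sqrt (h x)) *\<^sub>R d) = - (mu *\<^sub>R w x))
      \<longleftrightarrow> (AE x in lebesgue_on {0..1}. (p has_vector_derivative (mu * sqrt \<bar>h x\<bar>) *\<^sub>R w x) (at x))"
    by (intro eventually_subst eventually_mono[OF h_pos] 2)
  ultimately show ?thesis
    unfolding mode_solution_def is_flux_def flux_system_def eventually_conj_iff by blast
qed

lemma mode_solution_exists:
  assumes "0 \<le> mu"
  obtains w p where "mode_solution h mu b w p"
proof -
  have "(\<lambda>x. mu * sqrt \<bar>h x\<bar>) integrable_on {0..1}"
    using has_integral_mass by (intro integrable_on_mult_right) auto
  then obtain w p where "flux_system (\<lambda>x. 1 / sqrt \<bar>h x\<bar>) (\<lambda>x. mu * sqrt \<bar>h x\<bar>) w p"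
      "w 0 = fst b" "w 1 = snd b"
    using flux_system_boundary_value[of "\<lambda>x. 1 / sqrt \<bar>h x\<bar>" "\<lambda>x. mu * sqrt \<bar>h x\<bar>" "fst b" "snd b"]
      has_integral_resistance inverse_sqrt_abs_pos assms by (auto simp: has_integral_integrable)
  then show thesis using that mode_solution_iff_flux_system by blast
qed

lemma mode_solution_unique:
  assumes mu: "0 \<le> mu" and "mode_solution h mu b w p" "mode_solution h mu b v \<sigma>" and x: "x \<in> {0..1}"
  shows "w x = v x" "p x = \<sigma> x"
proof -
  have 1: "flux_system (\<lambda>x. 1 / sqrt \<bar>h x\<bar>) (\<lambda>x. mu * sqrt \<bar>h x\<bar>) w p" "w 0 = fst b" "w 1 = snd b"
    and 2: "flux_system (\<lambda>x. 1 / sqrt \<bar>h x\<bar>) (\<lambda>x. mu * sqrt \<bar>h x\<bar>) v \<sigma>" "v 0 = fst b" "v 1 = snd b"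
    using assms(2,3) by (auto simp: mode_solution_iff_flux_system)
  have diff: "flux_system (\<lambda>x. 1 / sqrt \<bar>h x\<bar>) (\<lambda>x. mu * sqrt \<bar>h x\<bar>) (\<lambda>x. w x + - v x) (\<lambda>x. p x + - \<sigma> x)"
    by (intro flux_system_add flux_system_bounded_linear[OF bounded_linear_minus[OF bounded_linear_ident]] 1 2)
  show "w x = v x" "p x = \<sigma> x"
    using flux_system_zero_boundary[OF _ _ diff _ _ inverse_sqrt_abs_pos x] mu 1 2 by auto
qed

lemma mode_solution_add:
  assumes "mode_solution h mu b w p" "mode_solution h mu b' v \<sigma>"
  shows "mode_solution h mu (b + b') (\<lambda>x. w x + v x) (\<lambda>x. p x + \<sigma> x)"
  using assms unfolding mode_solution_iff_flux_system by (auto intro: flux_system_add)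

lemma mode_solution_mult:
  assumes "mode_solution h mu b w p"
  shows "mode_solution h mu (a * fst b, a * snd b) (\<lambda>x. a * w x) (\<lambda>x. a * p x)"
  using assms unfolding mode_solution_iff_flux_system
  by (auto intro: flux_system_bounded_linear[OF bounded_linear_mult_right])

text \<open>The sum of the boundary values replaces their maximum because it is what the later estimates
  square. It depends neither on \<open>mu\<close> nor on \<open>x\<close>, so square-summable data dominate the coefficients of
  \<open>u\<close> at every \<open>x\<close>.\<close>

lemma mode_solution_norm_le:
  assumes "0 \<le> mu" "mode_solution h mu b w p" "x \<in> {0..1}"
  shows "norm (w x) \<le> norm (fst b) + norm (snd b)"
proof -
  have "norm (w x) \<le> max (norm (w 0)) (norm (w 1))"
    using assms by (intro flux_system_norm_le[of "\<lambda>x. 1 / sqrt \<bar>h x\<bar>" "\<lambda>x. mu * sqrt \<bar>h x\<bar>" w p])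
      (auto simp: mode_solution_iff_flux_system)
  also have "\<dots> \<le> norm (w 0) + norm (w 1)" by simp
  finally show ?thesis using assms by (simp add: mode_solution_iff_flux_system)
qed

text \<open>Here \<open>mu\<close> enters only through \<open>\<integral> q = mu \<integral> \<surd>h\<close>, so the bound grows
  linearly in \<open>mu\<close>.\<close>

lemma mode_solution_flux_le:
  assumes mu: "0 \<le> mu" and sol: "mode_solution h mu b w p" and x: "x \<in> {0..1}"
  shows "norm (p x) \<le> (mass + 2 / resistance) * (1 + mu) * (norm (fst b) + norm (snd b))"
proof -
  have sys: "flux_system (\<lambda>x. 1 / sqrt \<bar>h x\<bar>) (\<lambda>x. mu * sqrt \<bar>h x\<bar>) w p"
    and bd: "norm (w 0) \<le> norm (fst b) + norm (snd b)" "norm (w 1) \<le> norm (fst b) + norm (snd b)"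
    using sol by (auto simp: mode_solution_iff_flux_system)
  have "norm (p x) \<le> (mu * mass + 2 / resistance) * (norm (fst b) + norm (snd b))"
    using flux_system_flux_bound[OF _ _ sys bd has_integral_resistance
        has_integral_mult_right[OF has_integral_mass] resistance_pos x] mu by auto
  also have "\<dots> \<le> ((mass + 2 / resistance) * (1 + mu)) * (norm (fst b) + norm (snd b))"
  proof (rule mult_right_mono)
    have "0 \<le> mu * (2 / resistance)" using mu resistance_pos by simp
    then show "mu * mass + 2 / resistance \<le> (mass + 2 / resistance) * (1 + mu)"
      using mass_nonneg by (simp only: distrib_left distrib_right mult.commute)
  qed simp
  finally show ?thesis .
qed

definition energy_const :: real where
  "energy_const = 2 * ((mass + 2 / resistance)\<^sup>2 * resistance + mass)"

lemma energy_const_nonneg: "0 \<le> energy_const"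
  using mass_nonneg resistance_pos by (simp add: energy_const_def)

text \<open>Almost everywhere \<open>\<surd>h |w'|\<^sup>2 = |p|\<^sup>2 / \<surd>h\<close>, and the pointwise bounds on \<open>p\<close> and \<open>w\<close> leave the
  integrable functions \<open>1/\<surd>h\<close> and \<open>\<surd>h\<close>. The square of the flux bound is where the power
  \<open>(1 + mu)\<^sup>2\<close>, hence \<open>H\<^sup>2\<close> data, comes from.\<close>

lemma mode_solution_energy_le:
  assumes mu: "0 \<le> mu" and sol: "mode_solution h mu b w p"
  shows "(\<integral>\<^sup>+x. ennreal (((norm (vector_derivative w (at x)))\<^sup>2 + mu * (norm (w x))\<^sup>2) * sqrt (h x))
      \<partial>lebesgue_on {0..1})
    \<le> ennreal (energy_const * ((1 + mu)\<^sup>2 * ((norm (fst b))\<^sup>2 + (norm (snd b))\<^sup>2)))"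
proof -
  define B where "B = norm (fst b) + norm (snd b)"
  define C where "C = (mass + 2 / resistance) * (1 + mu) * B"
  define M where "M x = C\<^sup>2 * (1 / sqrt \<bar>h x\<bar>) + mu * B\<^sup>2 * sqrt \<bar>h x\<bar>" for x
  have M_int: "integrable (lebesgue_on {0..1}) M"
    unfolding M_def using integrable_sqrt_abs integrable_inverse_sqrt_abs
    by (intro Bochner_Integration.integrable_add integrable_mult_right)
  have M_nonneg: "0 \<le> M x" for x using mu by (simp add: M_def)
  have der: "AE x in lebesgue_on {0..1}. (w has_vector_derivative (1 / sqrt \<bar>h x\<bar>) *\<^sub>R p x) (at x)"
    using sol by (auto simp: mode_solution_iff_flux_system flux_system_def)
  have mem: "AE x in lebesgue_on {0..1::real}. x \<in> {0..1}" by (auto intro: AE_I2)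
  have "AE x in lebesgue_on {0..1}.
      ennreal (((norm (vector_derivative w (at x)))\<^sup>2 + mu * (norm (w x))\<^sup>2) * sqrt (h x)) \<le> ennreal (M x)"
    using der h_pos mem
  proof eventually_elim
    case (elim x)
    have "(norm (vector_derivative w (at x)))\<^sup>2 = (norm (p x))\<^sup>2 / h x"
      using vector_derivative_at[OF elim(1)] elim(2) by (simp add: power_divide)
    moreover have "1 / h x * sqrt (h x) = 1 / sqrt (h x)"
      using elim(2) real_div_sqrt[of "h x"] by (simp add: field_simps)
    ultimately have "((norm (vector_derivative w (at x)))\<^sup>2 + mu * (norm (w x))\<^sup>2) * sqrt (h x)
        = (norm (p x))\<^sup>2 * (1 / sqrt (h x)) + mu * (norm (w x))\<^sup>2 * sqrt (h x)"
      by (simp add: distrib_right) (metis mult.right_neutral times_divide_eq_left times_divide_eq_right)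
    also have "\<dots> \<le> C\<^sup>2 * (1 / sqrt (h x)) + mu * B\<^sup>2 * sqrt (h x)"
    proof (intro add_mono mult_right_mono mult_left_mono power_mono)
      show "norm (p x) \<le> C" unfolding C_def B_def using mu sol elim(3) by (rule mode_solution_flux_le)
      show "norm (w x) \<le> B" unfolding B_def using mu sol elim(3) by (rule mode_solution_norm_le)
    qed (use mu elim(2) in auto)
    finally show ?case using elim(2) by (intro ennreal_leI) (simp add: M_def)
  qed
  then have "(\<integral>\<^sup>+x. ennreal (((norm (vector_derivative w (at x)))\<^sup>2 + mu * (norm (w x))\<^sup>2) * sqrt (h x))
      \<partial>lebesgue_on {0..1}) \<le> (\<integral>\<^sup>+x. ennreal (M x) \<partial>lebesgue_on {0..1})"
    by (rule nn_integral_mono_AE)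
  also have "\<dots> = ennreal (LINT x|lebesgue_on {0..1}. M x)"
    using M_nonneg by (intro nn_integral_eq_integral M_int) auto
  also have "(LINT x|lebesgue_on {0..1}. M x) = C\<^sup>2 * resistance + mu * B\<^sup>2 * mass"
    unfolding M_def resistance_def mass_def
    by (simp only: Bochner_Integration.integral_add integrable_mult_right integral_mult_right_zero
        integrable_sqrt_abs integrable_inverse_sqrt_abs)
  also have "C\<^sup>2 * resistance + mu * B\<^sup>2 * mass
      \<le> energy_const * ((1 + mu)\<^sup>2 * ((norm (fst b))\<^sup>2 + (norm (snd b))\<^sup>2))"
  proof -
    have C2: "C\<^sup>2 = (mass + 2 / resistance)\<^sup>2 * (1 + mu)\<^sup>2 * B\<^sup>2"
      by (simp only: C_def power_mult_distrib)
    have "mu \<le> (1 + mu)\<^sup>2" using mu by (simp add: power2_eq_square algebra_simps)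
    then have "mu * (B\<^sup>2 * mass) \<le> (1 + mu)\<^sup>2 * (B\<^sup>2 * mass)"
      using mass_nonneg by (intro mult_right_mono) auto
    then have "C\<^sup>2 * resistance + mu * B\<^sup>2 * mass
        \<le> ((mass + 2 / resistance)\<^sup>2 * resistance + mass) * (1 + mu)\<^sup>2 * B\<^sup>2"
      by (simp add: C2 distrib_left distrib_right mult_ac)
    also have "\<dots> \<le> ((mass + 2 / resistance)\<^sup>2 * resistance + mass) * (1 + mu)\<^sup>2
        * (2 * ((norm (fst b))\<^sup>2 + (norm (snd b))\<^sup>2))"
      unfolding B_def using mass_nonneg resistance_pos
      by (intro mult_left_mono sum_squared_le mult_nonneg_nonneg add_nonneg_nonneg) auto
    finally show ?thesis by (simp add: energy_const_def algebra_simps)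
  qed
  then have "ennreal (C\<^sup>2 * resistance + mu * B\<^sup>2 * mass)
      \<le> ennreal (energy_const * ((1 + mu)\<^sup>2 * ((norm (fst b))\<^sup>2 + (norm (snd b))\<^sup>2)))"
    by (rule ennreal_leI)
  finally show ?thesis .
qed

section \<open>The Dirichlet problem and the Dirichlet-to-Neumann map\<close>

lemma dirichlet_solution_exists:
  assumes Y: "orthonormal_basis_L2 V Y" and \<mu>: "\<And>m. 0 \<le> \<mu> m" and \<psi>: "\<psi> \<in> Hs \<mu> 2"
  obtains u where "u \<in> H1_dot h \<mu> V Y" "dirichlet_solution h \<mu> V Y \<psi> u"
proof -
  define a where "a m = (norm (fst (\<psi> m)))\<^sup>2 + (norm (snd (\<psi> m)))\<^sup>2" for m
  have term_eq: "Hs_term \<mu> 2 \<psi> m = (1 + \<mu> m)\<^sup>2 * a m" for m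
    using \<mu>[of m] by (simp add: Hs_term_def a_def powr_numeral)
  have "Hs_term \<mu> 2 \<psi> = (\<lambda>m. (1 + \<mu> m)\<^sup>2 * a m)" by (rule ext) (rule term_eq)
  then have sumH: "summable (\<lambda>m. (1 + \<mu> m)\<^sup>2 * a m)" using \<psi> by (simp add: Hs_def)
  have a_nonneg: "0 \<le> a m" for m by (simp add: a_def)
  have "a m \<le> (1 + \<mu> m)\<^sup>2 * a m" for m
    using mult_right_mono[of 1 "(1 + \<mu> m)\<^sup>2" "a m"] a_nonneg \<mu>[of m] by simp
  then have suma: "summable a"
    using a_nonneg by (intro summable_comparison_test'[OF sumH]) auto
  have "\<forall>m. \<exists>w p. mode_solution h (\<mu> m) (\<psi> m) w p" using mode_solution_exists[OF \<mu>] by metis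
  then obtain c p where cp: "\<And>m. mode_solution h (\<mu> m) (\<psi> m) (c m) (p m)" by metis
  have ac: "absolutely_continuous_on 0 1 (c m)" for m using cp[of m] by (simp add: mode_solution_def)
  have mc: "c m \<in> borel_measurable (lebesgue_on {0..1})" for m
    using absolutely_continuous_on_imp_continuous_on[OF ac]
    by (rule continuous_imp_measurable_on_sets_lebesgue) simp
  have bound: "(norm (c m x))\<^sup>2 \<le> 2 * a m" if "x \<in> space (lebesgue_on {0..1})" for m x
  proof -
    have "(norm (c m x))\<^sup>2 \<le> (norm (fst (\<psi> m)) + norm (snd (\<psi> m)))\<^sup>2"
      using mode_solution_norm_le[OF \<mu> cp, of x] that by (intro power_mono) auto
    also have "\<dots> \<le> 2 * a m" unfolding a_def by (rule sum_squared_le)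
    finally show ?thesis .
  qed
  obtain u where u: "(\<lambda>(x, k). u x k) \<in> borel_measurable (lebesgue_on {0..1} \<Otimes>\<^sub>M V)"
    "\<And>x. x \<in> space (lebesgue_on {0..1}) \<Longrightarrow> L2_expansion V Y (\<lambda>m. c m x) (u x)"
    using L2_expansion_exists_measurable[of V Y c _ "\<lambda>m. 2 * a m", OF Y mc summable_mult[OF suma, of 2] bound]
      a_nonneg by auto
  then have exp: "harmonic_expansion V Y c u"
    unfolding harmonic_expansion_def by (auto intro: AE_I2)
  have "(\<Sum>m. \<integral>\<^sup>+x. ennreal (((norm (vector_derivative (c m) (at x)))\<^sup>2 + \<mu> m * (norm (c m x))\<^sup>2)
      * sqrt (h x)) \<partial>lebesgue_on {0..1}) \<le> (\<Sum>m. ennreal (energy_const * ((1 + \<mu> m)\<^sup>2 * a m)))"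
    unfolding a_def by (rule suminf_le[OF mode_solution_energy_le[OF \<mu> cp]]) auto
  also have "\<dots> = ennreal (\<Sum>m. energy_const * ((1 + \<mu> m)\<^sup>2 * a m))"
    using a_nonneg energy_const_nonneg by (intro suminf_ennreal2 summable_mult sumH) auto
  also have "\<dots> < \<infinity>" by simp
  finally have "u \<in> H1_dot h \<mu> V Y" unfolding H1_dot_def using exp ac by blast
  moreover have "dirichlet_solution h \<mu> V Y \<psi> u" unfolding dirichlet_solution_def using exp cp by blast
  ultimately show thesis by (rule that)
qed

lemma dirichlet_solution_unique:
  assumes Y: "orthonormal_basis_L2 V Y" and \<mu>: "\<And>m. 0 \<le> \<mu> m"
    and u: "dirichlet_solution h \<mu> V Y \<psi> u" and v: "dirichlet_solution h \<mu> V Y \<psi> v"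
  shows "AE x in lebesgue_on {0..1}. AE k in V. u x k = v x k"
proof -
  have mY: "Y m \<in> borel_measurable V" for m
    using Y by (auto simp: orthonormal_basis_L2_def L2_space_def)
  obtain c p where c: "harmonic_expansion V Y c u" "\<And>m. mode_solution h (\<mu> m) (\<psi> m) (c m) (p m)"
    using u unfolding dirichlet_solution_def by metis
  obtain d q where d: "harmonic_expansion V Y d v" "\<And>m. mode_solution h (\<mu> m) (\<psi> m) (d m) (q m)"
    using v unfolding dirichlet_solution_def by metis
  have "AE x in lebesgue_on {0..1}. L2_expansion V Y (\<lambda>m. c m x) (u x)"
    "AE x in lebesgue_on {0..1}. L2_expansion V Y (\<lambda>m. d m x) (v x)"
    "AE x in lebesgue_on {0..1::real}. x \<in> {0..1}"
    using c d by (auto simp: harmonic_expansion_def intro: AE_I2)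
  then show ?thesis
  proof eventually_elim
    case (elim x)
    have "(\<lambda>m. c m x) = (\<lambda>m. d m x)"
      using mode_solution_unique(1)[OF \<mu> c(2) d(2) elim(3)] by auto
    then show ?case using L2_expansion_unique[OF mY elim(1)] elim(2) by simp
  qed
qed

lemma DN_graph_ex1:
  assumes \<mu>: "\<And>m. 0 \<le> \<mu> m"
  shows "\<exists>!\<phi>. DN_graph h \<mu> \<psi> \<phi>"
proof -
  have "\<forall>m. \<exists>w p. mode_solution h (\<mu> m) (\<psi> m) w p" using mode_solution_exists[OF \<mu>] by metis
  then obtain w p where "\<And>m. mode_solution h (\<mu> m) (\<psi> m) (w m) (p m)" by metis
  then have "DN_graph h \<mu> \<psi> (\<lambda>m. (- p m 0, p m 1))" unfolding DN_graph_def by blast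
  moreover have "\<phi> = \<phi>'" if "DN_graph h \<mu> \<psi> \<phi>" "DN_graph h \<mu> \<psi> \<phi>'" for \<phi> \<phi>'
  proof
    fix m
    obtain w p where 1: "mode_solution h (\<mu> m) (\<psi> m) w p" "\<phi> m = (- p 0, p 1)"
      using \<open>DN_graph h \<mu> \<psi> \<phi>\<close> unfolding DN_graph_def by blast
    obtain w' p' where 2: "mode_solution h (\<mu> m) (\<psi> m) w' p'" "\<phi>' m = (- p' 0, p' 1)"
      using \<open>DN_graph h \<mu> \<psi> \<phi>'\<close> unfolding DN_graph_def by blast
    show "\<phi> m = \<phi>' m"
      using mode_solution_unique(2)[OF \<mu> 1(1) 2(1)] 1(2) 2(2) by simp
  qed
  ultimately show ?thesis by blast
qed

lemma DN_graph_DN_map: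
  assumes "\<And>m. 0 \<le> \<mu> m"
  shows "DN_graph h \<mu> \<psi> (DN_map h \<mu> \<psi>)"
  unfolding DN_map_def by (rule theI'[OF DN_graph_ex1[of \<mu>, OF assms]])

lemma DN_map_eqI:
  assumes "\<And>m. 0 \<le> \<mu> m" "DN_graph h \<mu> \<psi> \<phi>"
  shows "DN_map h \<mu> \<psi> = \<phi>"
  using DN_graph_ex1[of \<mu> \<psi>] DN_graph_DN_map[of \<mu> \<psi>] assms by blast

text \<open>Linearity follows from uniqueness, as sums and multiples of mode solutions are mode solutions for
  the sums and multiples of the data. The flux bound, squared, compares the two norms term by term:
  \<open>(1 + \<mu>\<^sub>m)\<^bsup>s-2\<^esup> (1 + \<mu>\<^sub>m)\<^sup>2 = (1 + \<mu>\<^sub>m)\<^bsup>s\<^esup>\<close>.\<close>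

lemma bounded_operator_DN_map:
  assumes \<mu>: "\<And>m. 0 \<le> \<mu> m"
  shows "bounded_operator_Hs \<mu> s (s - 2) (DN_map h \<mu>)"
proof -
  define C where "C = mass + 2 / resistance"
  have C: "0 \<le> C" using mass_nonneg resistance_pos by (simp add: C_def)
  have add: "DN_map h \<mu> (\<lambda>m. \<psi> m + \<phi> m) = (\<lambda>m. DN_map h \<mu> \<psi> m + DN_map h \<mu> \<phi> m)"
    for \<psi> \<phi> :: boundary_data
  proof (rule DN_map_eqI[of \<mu>, OF \<mu>])
    show "DN_graph h \<mu> (\<lambda>m. \<psi> m + \<phi> m) (\<lambda>m. DN_map h \<mu> \<psi> m + DN_map h \<mu> \<phi> m)"
      unfolding DN_graph_def
    proof
      fix m
      obtain w p where 1: "mode_solution h (\<mu> m) (\<psi> m) w p" "DN_map h \<mu> \<psi> m = (- p 0, p 1)"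
        using DN_graph_DN_map[of \<mu> \<psi>, OF \<mu>] unfolding DN_graph_def by blast
      obtain v \<sigma> where 2: "mode_solution h (\<mu> m) (\<phi> m) v \<sigma>" "DN_map h \<mu> \<phi> m = (- \<sigma> 0, \<sigma> 1)"
        using DN_graph_DN_map[of \<mu> \<phi>, OF \<mu>] unfolding DN_graph_def by blast
      show "\<exists>w p. mode_solution h (\<mu> m) (\<psi> m + \<phi> m) w p \<and> DN_map h \<mu> \<psi> m + DN_map h \<mu> \<phi> m = (- p 0, p 1)"
        using mode_solution_add[OF 1(1) 2(1)] 1(2) 2(2) by fastforce
    qed
  qed
  have scale: "DN_map h \<mu> (\<lambda>m. (a * fst (\<psi> m), a * snd (\<psi> m)))
      = (\<lambda>m. (a * fst (DN_map h \<mu> \<psi> m), a * snd (DN_map h \<mu> \<psi> m)))" for a and \<psi> :: boundary_data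
  proof (rule DN_map_eqI[of \<mu>, OF \<mu>])
    show "DN_graph h \<mu> (\<lambda>m. (a * fst (\<psi> m), a * snd (\<psi> m)))
        (\<lambda>m. (a * fst (DN_map h \<mu> \<psi> m), a * snd (DN_map h \<mu> \<psi> m)))"
      unfolding DN_graph_def
    proof
      fix m
      obtain w p where 1: "mode_solution h (\<mu> m) (\<psi> m) w p" "DN_map h \<mu> \<psi> m = (- p 0, p 1)"
        using DN_graph_DN_map[of \<mu> \<psi>, OF \<mu>] unfolding DN_graph_def by blast
      show "\<exists>w p. mode_solution h (\<mu> m) (a * fst (\<psi> m), a * snd (\<psi> m)) w p \<and>
          (a * fst (DN_map h \<mu> \<psi> m), a * snd (DN_map h \<mu> \<psi> m)) = (- p 0, p 1)"
        using mode_solution_mult[OF 1(1), of a] 1(2) by fastforce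
    qed
  qed
  have term_le: "Hs_term \<mu> (s - 2) (DN_map h \<mu> \<psi>) m \<le> (2 * C)\<^sup>2 * Hs_term \<mu> s \<psi> m" for \<psi> m
  proof -
    obtain w p where 1: "mode_solution h (\<mu> m) (\<psi> m) w p" "DN_map h \<mu> \<psi> m = (- p 0, p 1)"
      using DN_graph_DN_map[of \<mu> \<psi>, OF \<mu>] unfolding DN_graph_def by blast
    define B where "B = norm (fst (\<psi> m)) + norm (snd (\<psi> m))"
    have p: "(norm (p x))\<^sup>2 \<le> (C * (1 + \<mu> m) * B)\<^sup>2" if "x \<in> {0..1}" for x
      unfolding C_def B_def by (intro power_mono mode_solution_flux_le[OF \<mu> 1(1) that]) simp
    have pos: "0 < 1 + \<mu> m" using \<mu>[of m] by simp
    have "Hs_term \<mu> (s - 2) (DN_map h \<mu> \<psi>) m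
        = (1 + \<mu> m) powr (s - 2) * ((norm (p 0))\<^sup>2 + (norm (p 1))\<^sup>2)"
      by (simp add: Hs_term_def 1(2))
    also have "\<dots> \<le> (1 + \<mu> m) powr (s - 2) * (2 * (C * (1 + \<mu> m) * B)\<^sup>2)"
      using p[of 0] p[of 1] by (intro mult_left_mono) auto
    also have "\<dots> = 2 * C\<^sup>2 * ((1 + \<mu> m) powr (s - 2) * (1 + \<mu> m)\<^sup>2) * B\<^sup>2"
      by (simp add: power_mult_distrib)
    also have "(1 + \<mu> m) powr (s - 2) * (1 + \<mu> m)\<^sup>2 = (1 + \<mu> m) powr s"
      using pos by (simp add: powr_diff powr_numeral)
    also have "2 * C\<^sup>2 * (1 + \<mu> m) powr s * B\<^sup>2
        \<le> 2 * C\<^sup>2 * (1 + \<mu> m) powr s * (2 * ((norm (fst (\<psi> m)))\<^sup>2 + (norm (snd (\<psi> m)))\<^sup>2))"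
      unfolding B_def by (intro mult_left_mono sum_squared_le) auto
    also have "\<dots> = (2 * C)\<^sup>2 * Hs_term \<mu> s \<psi> m"
      by (simp add: Hs_term_def power_mult_distrib)
    finally show ?thesis .
  qed
  have nonneg: "0 \<le> Hs_term \<mu> t \<phi> m" for t \<phi> m by (simp add: Hs_term_def)
  have "DN_map h \<mu> \<psi> \<in> Hs \<mu> (s - 2) \<and> Hs_norm \<mu> (s - 2) (DN_map h \<mu> \<psi>) \<le> 2 * C * Hs_norm \<mu> s \<psi>"
    if "\<psi> \<in> Hs \<mu> s" for \<psi>
  proof
    have sum: "summable (\<lambda>m. (2 * C)\<^sup>2 * Hs_term \<mu> s \<psi> m)"
      using that by (intro summable_mult) (simp add: Hs_def)
    then have sum': "summable (Hs_term \<mu> (s - 2) (DN_map h \<mu> \<psi>))"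
      by (rule summable_comparison_test') (use term_le nonneg in auto)
    then show "DN_map h \<mu> \<psi> \<in> Hs \<mu> (s - 2)" by (simp add: Hs_def)
    have "(\<Sum>m. Hs_term \<mu> (s - 2) (DN_map h \<mu> \<psi>) m) \<le> (\<Sum>m. (2 * C)\<^sup>2 * Hs_term \<mu> s \<psi> m)"
      using term_le sum' sum by (rule suminf_le)
    also have "\<dots> = (2 * C)\<^sup>2 * (\<Sum>m. Hs_term \<mu> s \<psi> m)"
      using that by (intro suminf_mult) (simp add: Hs_def)
    finally have "Hs_norm \<mu> (s - 2) (DN_map h \<mu> \<psi>) \<le> sqrt ((2 * C)\<^sup>2 * (\<Sum>m. Hs_term \<mu> s \<psi> m))"
      unfolding Hs_norm_def by (rule real_sqrt_le_mono)
    then show "Hs_norm \<mu> (s - 2) (DN_map h \<mu> \<psi>) \<le> 2 * C * Hs_norm \<mu> s \<psi>"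
      using C by (simp add: Hs_norm_def real_sqrt_mult)
  qed
  then show ?thesis unfolding bounded_operator_Hs_def using add scale by blast
qed

end

theorem theorem4p1:
  fixes K :: "'k topology"
    and A :: "('k, 'n::finite) chart set"
    and G :: "('k, 'n) metric_components"
    and V :: "'k measure"
    and Y :: "nat \<Rightarrow> 'k \<Rightarrow> complex"
    and \<mu> :: "nat \<Rightarrow> real"
    and h1 h :: "real \<Rightarrow> real"
  assumes "CARD('n) \<ge> 2"
    and "closed_riemannian_manifold K A G"
    and "riemannian_volume K A G V"
    and "orthonormal_basis_L2 V Y"
    and "\<And>m. laplace_eigenfunction A G (\<mu> m) (Y m)"
    and "\<mu> 0 = 0" and "0 < \<mu> 1" and "\<And>m. 1 \<le> m \<Longrightarrow> \<mu> m \<le> \<mu> (Suc m)"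
    and "filterlim \<mu> at_top sequentially"
    and "h1 \<in> borel_measurable (lebesgue_on {0..1})"
    and "AE x in lebesgue_on {0..1}. h1 x > 0"
    and "h = (\<lambda>x. h1 x ^ (CARD('n) - 1))"
    and "integrable (lebesgue_on {0..1}) (\<lambda>x. sqrt (h x))"
    and "integrable (lebesgue_on {0..1}) (\<lambda>x. 1 / sqrt (h x))"
  shows "(\<forall>\<psi>\<in>Hs \<mu> 2.
            (\<exists>u. u \<in> H1_dot h \<mu> V Y \<and> dirichlet_solution h \<mu> V Y \<psi> u) \<and>
            (\<forall>u v. u \<in> H1_dot h \<mu> V Y \<and> dirichlet_solution h \<mu> V Y \<psi> u \<and>
                   v \<in> H1_dot h \<mu> V Y \<and> dirichlet_solution h \<mu> V Y \<psi> v \<longrightarrow>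
                   (AE x in lebesgue_on {0..1}. AE k in V. u x k = v x k)))
       \<and> (\<forall>s. (\<forall>\<psi>\<in>Hs \<mu> s. \<exists>!\<phi>. DN_graph h \<mu> \<psi> \<phi>) \<and>
              bounded_operator_Hs \<mu> s (s - 2) (DN_map h \<mu>))"
proof -
  have "0 < \<mu> (Suc m)" for m
  proof (induction m)
    case 0
    then show ?case using assms(7) by simp
  next
    case (Suc m)
    then show ?case using assms(8)[of "Suc m"] by simp
  qed
  then have \<mu>: "0 \<le> \<mu> m" for m using assms(6) by (cases m) (auto intro: less_imp_le)
  have "AE x in lebesgue_on {0..1}. 0 < h x"
    using assms(11) by eventually_elim (simp add: assms(12))
  then interpret integrable_weight h by unfold_locales (use assms(13,14) in auto)
  show ?thesis
    using dirichlet_solution_exists[of V Y \<mu>, OF assms(4) \<mu>] dirichlet_solution_unique[of V Y \<mu>, OF assms(4) \<mu>]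
      DN_graph_ex1[of \<mu>, OF \<mu>] bounded_operator_DN_map[of \<mu>, OF \<mu>]
    by (intro conjI ballI allI impI) (metis, blast+)
qed

end
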